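(* Let $n$ be a positive integer. For $v\in Z_4^n$ and $i=0,1,2,3$, let $f_i$ be the number of entries of $v$ equal to $i$. Let $D$ be the $2^{2n}\times(2n+2)$ design generated by $G=(v,I_n)$, where $v$ satisfies: $f_1+f_3=2k-1$, $f_2=k$ if $n=3k-1$; $f_1+f_3=2k$, $f_2=k$ if $n=3k$; $f_1+f_3=2k$, $f_2=k+1$ if $n=3k+1$ (with $k\ge1$ in each case). Let $D'$ be a half-fraction of $D$. Then, among all $2^{2n-1}\times(2n+1)$ designs that are half-fractions of designs generated by $(w,I_n)$, $w\in Z_4^n$, the design $D'$ has both maximum resolution and minimum aberration in each of the following cases: (a) $n=3k-1$, $k\ge1$, and the branching column is associated with number 2. In this case the resolution of $D'$ is $4k-2^{-(k-1)}$ and the wordlength pattern is $A_{4k-1}(D')=2$ and $A_{4k}(D')=1$. (b) $n=3k$, $k\ge1$, and the branching column is associated with number 1. In this case the resolution of $D'$ is $4k+1-2^{-k}$ and the wordlength pattern is $A_{4k}(D')=1$ and $A_{4k+1}(D')=2$. (c) $n=3k+1$, $k\ge1$, and the branching column is associated with number 2. In this case the resolution of $D'$ is $4k+2$ and the wordlength pattern is $A_{4k+2}(D')=3$.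
   Context: $Z_4=\{0,1,2,3\}$ is the ring of integers modulo 4. Design generated by $G=(v,I_n)$: let $C$ be the $2^{2n}\times(n+1)$ matrix whose rows are all linear combinations $uG$, $u\in Z_4^n$. Replace each entry of $C$ by a pair of $\pm1$ symbols via the Gray map $0\mapsto(1,1)$, $1\mapsto(1,-1)$, $2\mapsto(-1,-1)$, $3\mapsto(-1,1)$, so that column $j$ of $C$ becomes columns $2j-1,2j$. The result $D$ is a $2^{2n}\times(2n+2)$ matrix with entries $\pm1$ (a two-level design; rows are runs, columns are factors). A column of $D$ is associated with number $z\in\{0,1,2,3\}$ if it is one of the two columns of $D$ arising from the $i$th column of $I_n$ for some $i$ such that the $i$th entry of $v$ is $z$ (i.e. columns $2i+1,2i+2$ of $D$). Half-fraction: choose a column of $D$ (the branching column) in which both symbols occur equally often, keep only the $2^{2n-1}$ runs in which this column takes one fixed symbol ($+1$ or $-1$), and delete the branching column; this gives a $2^{2n-1}\times(2n+1)$ design. For a two-level design $D$ with $N$ runs and $m$ factors and a nonempty set $s$ of $k$ columns, let $\rho_k(s;D)=\frac1N\left|\sum_{i=1}^N\prod_{c\in s}c_i\right|$, where $c_i$ is the $i$th entry of column $c$. Resolution: let $r$ be the smallest integer with $\max_{|s|=r}\rho_r(s;D)>0$; then $R(D)=r+1-\max_{|s|=r}\rho_r(s;D)$. Wordlength pattern: $(A_1(D),\dots,A_m(D))$ with $A_k(D)=\sum_{|s|=k}\rho_k(s;D)^2$; when it is specified by listing some components, all unlisted components are zero. A design has maximum resolution among a class if no design in the class has larger resolution.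 It has minimum aberration among a class (with the same $N$ and $m$) if its wordlength pattern is lexicographically smallest (comparing $A_1$ first, then $A_2$, etc.) in the class. *)

theory Defs
  imports
    Complex_Main
    "HOL-Library.Numeral_Type"
    "Jordan_Normal_Form.Matrix"
begin

(* The numeral type 4 of HOL-Library.Numeral_Type is the ring of integers modulo 4. *)

type_synonym z4 = 4

text \<open>
  A design is a matrix whose rows (runs) and columns (factors) are labelled by finite sets. Only
  the values of the entry function on these two sets are relevant. Distinct runs may have
  identical rows.
\<close>

record 'r design =
  runs :: "'r set"
  factors :: "nat set"
  entry :: "'r \<Rightarrow> nat \<Rightarrow> int"

definition rho :: "'r design \<Rightarrow> nat set \<Rightarrow> real" where
  "rho D s = real_of_int \<bar>\<Sum>i\<in>runs D. \<Prod>c\<in>s. entry D i c\<bar> / real (card (runs D))"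

definition factor_subsets :: "'r design \<Rightarrow> nat \<Rightarrow> nat set set" where
  "factor_subsets D k = {s. s \<subseteq> factors D \<and> card s = k}"

definition max_rho :: "'r design \<Rightarrow> nat \<Rightarrow> real" where
  "max_rho D k = Max (rho D ` factor_subsets D k)"

definition resolution :: "'r design \<Rightarrow> real" where
  "resolution D =
    (let r = (LEAST r. r \<in> {1..card (factors D)} \<and> max_rho D r > 0)
     in real r + 1 - max_rho D r)"

definition wordlength :: "'r design \<Rightarrow> nat \<Rightarrow> real" where
  "wordlength D k = (\<Sum>s\<in>factor_subsets D k. (rho D s)\<^sup>2)"

definition wordlength_pattern :: "'r design \<Rightarrow> real list" where
  "wordlength_pattern D = map (wordlength D) [1..<card (factors D) + 1]"

definition maximum_resolution :: "'r design set \<Rightarrow> 'r design \<Rightarrow> bool" where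
  "maximum_resolution K D \<longleftrightarrow> D \<in> K \<and> (\<forall>E\<in>K. resolution E \<le> resolution D)"

text \<open>
  Here \<open>lexordp_eq\<close> is the non-strict lexicographic order on lists. The notion is meant for
  classes of designs that all have the same numbers of runs and factors.
\<close>

definition minimum_aberration :: "'r design set \<Rightarrow> 'r design \<Rightarrow> bool" where
  "minimum_aberration K D \<longleftrightarrow>
    D \<in> K \<and>
    (\<forall>E\<in>K. ord_class.lexordp_eq (wordlength_pattern D) (wordlength_pattern E))"

definition gray :: "z4 \<Rightarrow> int \<times> int" where
  "gray z =
    (if z = 0 then (1, 1)
     else if z = 1 then (1, -1)
     else if z = 2 then (-1, -1)
     else (-1, 1))"

definition generator_matrix :: "z4 vec \<Rightarrow> z4 mat" where
  "generator_matrix v = mat_of_cols (dim_vec v) (v # unit_vecs (dim_vec v))"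

text \<open>
  The run labelled by \<open>u\<close> comes from the row vector \<open>u G\<close>, which is written as the transpose of
  \<open>G\<close> applied to \<open>u\<close>. Columns are numbered from \<open>0\<close>, so that column \<open>j\<close> of the quaternary matrix
  gives the factors \<open>2 * j\<close> and \<open>2 * j + 1\<close>.
\<close>

definition generated_design :: "z4 vec \<Rightarrow> z4 vec design" where
  "generated_design v =
    \<lparr>runs = carrier_vec (dim_vec v),
     factors = {0..<2 * dim_vec v + 2},
     entry = (\<lambda>u c.
       let p = gray ((transpose_mat (generator_matrix v) *\<^sub>v u) $ (c div 2))
       in if even c then fst p else snd p)\<rparr>"

text \<open>
  Column \<open>0\<close> of the generator matrix is \<open>v\<close>, so column \<open>i\<close> of the identity matrix (counted from
  \<open>0\<close>) is column \<open>i + 1\<close> of the generator matrix.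
\<close>

definition associated :: "z4 vec \<Rightarrow> nat \<Rightarrow> z4 \<Rightarrow> bool" where
  "associated v c z \<longleftrightarrow>
    (\<exists>i<dim_vec v. v $ i = z \<and> c \<in> {2 * (i + 1), 2 * (i + 1) + 1})"

definition balanced :: "'r design \<Rightarrow> nat \<Rightarrow> bool" where
  "balanced D c \<longleftrightarrow>
    card {u \<in> runs D. entry D u c = 1} = card {u \<in> runs D. entry D u c = -1}"

text \<open>The remaining runs and factors keep their labels.\<close>

definition half_fraction :: "'r design \<Rightarrow> nat \<Rightarrow> 'r design \<Rightarrow> bool" where
  "half_fraction D b D' \<longleftrightarrow>
    b \<in> factors D \<and> balanced D b \<and>
    (\<exists>x\<in>{1, -1}.
      D' = \<lparr>runs = {u \<in> runs D. entry D u b = x},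
            factors = factors D - {b},
            entry = entry D\<rparr>)"

definition half_fractions :: "nat \<Rightarrow> z4 vec design set" where
  "half_fractions n =
    {E. \<exists>w\<in>carrier_vec n. \<exists>b. half_fraction (generated_design w) b E}"

definition freq :: "z4 vec \<Rightarrow> z4 \<Rightarrow> nat" where
  "freq v z = card {i. i < dim_vec v \<and> v $ i = z}"

end

theory Submission
  imports Defs
begin

text \<open>
  Let \<open>f\<close> and \<open>g\<close> be the numbers of odd entries and of entries \<open>2\<close> of \<open>v\<close>. The Gray image of
  \<open>z\<close> consists of the real parts of \<open>(1 - \<i>) \<i>^z\<close> and \<open>(1 + \<i>) \<i>^z\<close>, and the product of the
  two signs is \<open>(-1)^z\<close>. So the sum over all runs of a product of columns factors over the
  positions into Fourier coefficients on the integers modulo 4. It vanishes except for the empty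
  word, one word \<open>odd_word\<close> of length \<open>2f + 2\<close>, and words of length \<open>f + 2g + 1\<close> that contain
  exactly one of the two columns coming from \<open>v\<close>. The latter all have
  \<open>\<rho> = 1 / 2^(f div 2)\<close>, and by Parseval their squares add up to \<open>2\<close>. Multiplication by
  \<open>odd_word\<close> shows that they split evenly according to whether they contain a given column of
  that word. Passing to a half-fraction just deletes the branching column from every word, which
  leaves three possible patterns; the rest is a comparison of lengths subject to \<open>f + g \<le> n\<close>.
\<close>

section \<open>Case analysis in Z_4 and the pairing of columns\<close>

lemma z4_exhaust:
  fixes z :: z4
  obtains "z = 0" | "z = 1" | "z = 2" | "z = 3"
proof (cases z rule: bit0_cases)
  case (of_int i)
  then have "i = 0 \<or> i = 1 \<or> i = 2 \<or> i = 3"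
    by auto
  with of_int that show ?thesis
    by auto
qed

lemma UNIV_z4: "(UNIV :: z4 set) = {0, 1, 2, 3}"
  using z4_exhaust by blast

lemma sum_pairs:
  fixes h :: "nat \<Rightarrow> 'a::comm_monoid_add"
  shows "(\<Sum>c<2 * m. h c) = (\<Sum>j<m. h (2 * j) + h (2 * j + 1))"
  by (induction m) (simp_all add: add.assoc)

lemma prod_pairs:
  fixes h :: "nat \<Rightarrow> 'a::comm_monoid_mult"
  shows "(\<Prod>c<2 * m. h c) = (\<Prod>j<m. h (2 * j) * h (2 * j + 1))"
  by (induction m) (simp_all add: mult.assoc)

section \<open>Characters of Z_4 and the Fourier coefficients of the Gray map\<close>

definition gray_word :: "bool \<Rightarrow> bool \<Rightarrow> z4 \<Rightarrow> int" where
  "gray_word p q z = (if p then fst (gray z) else 1) * (if q then snd (gray z) else 1)"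

text \<open>The additive character \<open>z \<mapsto> \<i>^z\<close> of Z_4, tabulated because its
  exponent is a residue class.\<close>

definition chi :: "z4 \<Rightarrow> complex" where
  "chi z = (if z = 0 then 1 else if z = 1 then \<i> else if z = 2 then -1 else - \<i>)"

text \<open>
  The constants \<open>twist\<close> and \<open>kappa\<close> are the exponent and the coefficient for which a product of
  Gray columns of \<open>z\<close> is the real part of \<open>kappa * chi (twist * z)\<close>.
\<close>

definition twist :: "bool \<Rightarrow> bool \<Rightarrow> z4" where
  "twist p q = of_bool p + of_bool q"

definition kappa :: "bool \<Rightarrow> bool \<Rightarrow> complex" where
  "kappa p q = (if p = q then 1 else if p then 1 - \<i> else 1 + \<i>)"

text \<open>The Lee weight on Z_4, which is the number of signs -1 in \<open>gray a\<close>. In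
  \<open>fourier_eq\<close> it is the number of Gray columns a word must take for the coefficient at
  \<open>a\<close> to survive.\<close>

definition gray_weight :: "z4 \<Rightarrow> nat" where
  "gray_weight a = (if a = 0 then 0 else if a = 2 then 2 else 1)"

definition fourier :: "z4 \<Rightarrow> bool \<Rightarrow> bool \<Rightarrow> complex" where
  "fourier a p q = (\<Sum>z\<in>UNIV. chi (a * z) * of_int (gray_word p q z))"

lemma chi_add: "chi (y + z) = chi y * chi z"
  by (cases y rule: z4_exhaust; cases z rule: z4_exhaust; simp add: chi_def)

lemma chi_sum: "chi (sum h A) = (\<Prod>i\<in>A. chi (h i))"
proof (induction A rule: infinite_finite_induct)
  case (insert i A)
  then show ?case by (simp add: chi_add)
qed (simp_all add: chi_def)

lemma gray_word_eq_Re: "real_of_int (gray_word p q z) = Re (kappa p q * chi (twist p q * z))"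
  by (cases p; cases q; cases z rule: z4_exhaust;
      simp add: gray_word_def gray_def kappa_def chi_def twist_def)

lemma chi_values: "chi 0 = 1" "chi 1 = \<i>" "chi 2 = -1" "chi 3 = - \<i>"
  by (simp_all add: chi_def)

lemma gray_values: "gray 0 = (1, 1)" "gray 1 = (1, -1)" "gray 2 = (-1, -1)" "gray 3 = (-1, 1)"
  by (simp_all add: gray_def)

lemma sum_UNIV_z4: "(\<Sum>z\<in>(UNIV :: z4 set). h z) = h 0 + h 1 + h 2 + h 3"
  unfolding UNIV_z4 by (simp add: add.assoc)

text \<open>Powers of \<open>chi a\<close> in place of \<open>chi (a * z)\<close> reduce the sixteen
  cases of \<open>fourier_eq\<close> to table lookups.\<close>

lemma fourier_expand:
  "fourier a p q = of_int (gray_word p q 0) + chi a * of_int (gray_word p q 1)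
    + chi a * chi a * of_int (gray_word p q 2) + chi a * chi a * chi a * of_int (gray_word p q 3)"
proof -
  have eqs: "a * 2 = a + a" "a * 3 = a + a + a"
    using distrib_left[of a 1 1] distrib_left[of a 2 1] by simp_all
  show ?thesis
    by (simp only: fourier_def sum_UNIV_z4 eqs chi_add chi_values mult_zero_right mult_1_left
        mult_1_right)
qed

lemma gray_weight_values:
  "gray_weight 0 = 0" "gray_weight 1 = 1" "gray_weight 2 = 2" "gray_weight 3 = 1"
  by (simp_all add: gray_weight_def)

text \<open>The constant 1 and the product of both Gray columns are the characters with index 0 and
  2. A single Gray column combines the two characters with odd index, with coefficients of modulus
  \<open>1 / sqrt 2\<close>. Hence the weight condition, and a value of modulus
  \<open>4 / sqrt 2\<close> at odd \<open>a\<close>.\<close>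

lemma fourier_eq:
  "fourier a p q =
    (if of_bool p + of_bool q \<noteq> gray_weight a then 0
     else if a = 0 \<or> a = 2 then 4
     else 2 * (if p = (a = 1) then 1 + \<i> else 1 - \<i>))"
  unfolding fourier_expand gray_word_def
  by (cases p; cases q; cases a rule: z4_exhaust;
      simp add: gray_values chi_values gray_weight_values)

section \<open>Sums over all vectors, powers of \<open>1 + \<i>\<close> and Parseval's
  identity\<close>

text \<open>The distributive law, with vectors in place of extensional functions on the positions.
  It lets a sum over all runs factor over the positions.\<close>

lemma prod_sum_carrier_vec:
  fixes h :: "nat \<Rightarrow> 'b::finite \<Rightarrow> 'a::comm_semiring_1"
  shows "(\<Sum>u\<in>carrier_vec n. \<Prod>i<n. h i (u $ i)) = (\<Prod>i<n. \<Sum>z\<in>UNIV. h i z)"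
proof -
  have "(\<Prod>i<n. \<Sum>z\<in>UNIV. h i z) = (\<Sum>g\<in>PiE {..<n} (\<lambda>_. UNIV). \<Prod>i<n. h i (g i))"
    by (rule prod_sum_PiE) auto
  also have "\<dots> = (\<Sum>u\<in>carrier_vec n. \<Prod>i<n. h i (u $ i))"
    by (rule sum.reindex_bij_witness[where j = "vec n" and i = "\<lambda>u. restrict (($) u) {..<n}"])
       (auto simp: PiE_def extensional_def fun_eq_iff intro!: prod.cong)
  finally show ?thesis by simp
qed

lemma carrier_vec_finite_card:
  "finite (carrier_vec n :: 'b::finite vec set) \<and> card (carrier_vec n :: 'b vec set) = CARD('b) ^ n"
proof -
  have "bij_betw (vec n) (PiE {..<n} (\<lambda>_. UNIV :: 'b set)) (carrier_vec n)"
    by (rule bij_betw_byWitness[where f' = "\<lambda>u. restrict (($) u) {..<n}"])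
       (auto simp: PiE_def extensional_def fun_eq_iff)
  moreover have "finite (PiE {..<n} (\<lambda>_. UNIV :: 'b set))"
    by (simp add: finite_PiE)
  moreover have "card (PiE {..<n} (\<lambda>_. UNIV :: 'b set)) = CARD('b) ^ n"
    by (simp add: card_PiE)
  ultimately show ?thesis
    using bij_betw_finite bij_betw_same_card by metis
qed

text \<open>Since \<open>1 - \<i> = - \<i> * (1 + \<i>)\<close>, the product is a power of
  \<open>1 + \<i>\<close> up to a unit, and \<open>(1 + \<i>)^2 = 2 * \<i>\<close> turns each pair
  of factors into a 2.\<close>

lemma prod_one_plus_minus_i:
  assumes "finite A" "\<And>i. i \<in> A \<Longrightarrow> z i \<in> {1 + \<i>, 1 - \<i>}"
  shows "\<exists>w\<in>{1, -1, \<i>, - \<i>}.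
    (\<Prod>i\<in>A. z i) = 2 ^ (card A div 2) * (if even (card A) then w else w * (1 + \<i>))"
  using assms
proof (induction A rule: finite_induct)
  case (insert a A)
  then obtain w where w: "w \<in> {1, -1, \<i>, - \<i>}"
    "(\<Prod>i\<in>A. z i) = 2 ^ (card A div 2) * (if even (card A) then w else w * (1 + \<i>))"
    by auto
  have "z a \<in> {1 + \<i>, 1 - \<i>}"
    using insert by simp
  then obtain w' where w': "w' \<in> {1, - \<i>}" "z a = w' * (1 + \<i>)"
    using that[of 1] that[of "- \<i>"] by (auto simp: algebra_simps)
  show ?case
  proof (cases "even (card A)")
    case True
    moreover have "w * w' \<in> {1, -1, \<i>, - \<i>}"
      using w w' by auto
    ultimately show ?thesis
      using insert w w' by (intro bexI[of _ "w * w'"]) (auto simp: mult_ac)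
  next
    case False
    have "\<i> * w * w' \<in> {1, -1, \<i>, - \<i>}"
      using w w' by auto
    moreover have "(1 + \<i>) * (1 + \<i>) = 2 * \<i>"
      by (simp add: algebra_simps)
    then have "w * (1 + \<i>) * (w' * (1 + \<i>)) = 2 * (\<i> * w * w')"
      by (metis (no_types, lifting) mult.assoc mult.commute)
    ultimately show ?thesis
      using insert w w' False
      by (intro bexI[of _ "\<i> * w * w'"]) (auto simp: mult_ac)
  qed
qed simp

text \<open>Parseval's identity: expand the product over \<open>F\<close> into a sum over subsets
  and interchange sums. For signs, that product is \<open>2 ^ card F\<close> if the rows
  \<open>u\<close> and \<open>t\<close> agree on \<open>F\<close>, and 0 otherwise.\<close>

lemma sum_squares_walsh:
  fixes e :: "'r \<Rightarrow> 'c \<Rightarrow> 'a::comm_ring_1"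
  assumes "finite F"
  shows "(\<Sum>s\<in>Pow F. (\<Sum>u\<in>R. \<Prod>c\<in>s. e u c)\<^sup>2) = (\<Sum>u\<in>R. \<Sum>t\<in>R. \<Prod>c\<in>F. 1 + e u c * e t c)"
proof -
  have "(\<Prod>c\<in>F. 1 + e u c * e t c) = (\<Sum>s\<in>Pow F. (\<Prod>c\<in>s. e u c) * (\<Prod>c\<in>s. e t c))" for u t
    using prod_add[OF assms, of "\<lambda>c. e u c * e t c" "\<lambda>_. 1"]
    by (simp add: add.commute prod.distrib)
  then have "(\<Sum>u\<in>R. \<Sum>t\<in>R. \<Prod>c\<in>F. 1 + e u c * e t c)
      = (\<Sum>u\<in>R. \<Sum>t\<in>R. \<Sum>s\<in>Pow F. (\<Prod>c\<in>s. e u c) * (\<Prod>c\<in>s. e t c))"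
    by simp
  also have "\<dots> = (\<Sum>u\<in>R. \<Sum>s\<in>Pow F. \<Sum>t\<in>R. (\<Prod>c\<in>s. e u c) * (\<Prod>c\<in>s. e t c))"
    by (intro sum.cong refl sum.swap)
  also have "\<dots> = (\<Sum>s\<in>Pow F. \<Sum>u\<in>R. \<Sum>t\<in>R. (\<Prod>c\<in>s. e u c) * (\<Prod>c\<in>s. e t c))"
    by (rule sum.swap)
  also have "\<dots> = (\<Sum>s\<in>Pow F. (\<Sum>u\<in>R. \<Prod>c\<in>s. e u c)\<^sup>2)"
    by (simp add: power2_eq_square sum_product)
  finally show ?thesis by simp
qed

lemma gray_eq_iff: "gray y = gray z \<longleftrightarrow> y = z"
  by (cases y rule: z4_exhaust; cases z rule: z4_exhaust; simp add: gray_def)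

text \<open>The product of the two Gray signs is \<open>(-1)^z\<close>, a homomorphism that sees
  only the parity of \<open>z\<close>.\<close>

lemma gray_word_True_add:
  "gray_word True True (y + z) = gray_word True True y * gray_word True True z"
  by (cases y rule: z4_exhaust; cases z rule: z4_exhaust; simp add: gray_word_def gray_def)

lemma gray_word_True_mult:
  "gray_word True True (a * z) = (if a \<in> {1, 3} then gray_word True True z else 1)"
  by (cases a rule: z4_exhaust; cases z rule: z4_exhaust; simp add: gray_word_def gray_def)

lemma gray_word_True_sum:
  "gray_word True True (sum h A) = (\<Prod>i\<in>A. gray_word True True (h i))"
proof (induction A rule: infinite_finite_induct)
  case (insert i A)
  then show ?case by (simp add: gray_word_True_add)
qed (simp_all add: gray_word_def gray_def)

section \<open>Words of the design generated by \<open>(v, I_n)\<close> and their sums over all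
  runs\<close>

locale quaternary_code =
  fixes n :: nat and v :: "z4 vec"
  assumes v: "v \<in> carrier_vec n"
begin

definition quat :: "z4 vec \<Rightarrow> nat \<Rightarrow> z4" where
  "quat u j = (case j of 0 \<Rightarrow> \<Sum>i<n. v $ i * u $ i | Suc i \<Rightarrow> u $ i)"

abbreviation sign :: "z4 vec \<Rightarrow> nat \<Rightarrow> int" where
  "sign \<equiv> entry (generated_design v)"

abbreviation words :: "nat set set" where
  "words \<equiv> Pow {..<2 * Suc n}"

text \<open>Signed and not normalised, unlike \<open>rho\<close>, because a half-fraction combines
  two such sums before the absolute value is taken.\<close>

definition char_sum :: "nat set \<Rightarrow> int" where
  "char_sum s = (\<Sum>u\<in>carrier_vec n. \<Prod>c\<in>s. sign u c)"

lemma generated_row: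
  assumes "u \<in> carrier_vec n" "j < Suc n"
  shows "(transpose_mat (generator_matrix v) *\<^sub>v u) $ j = quat u j"
proof (cases j)
  case 0
  then show ?thesis
    using assms v
    by (auto simp: generator_matrix_def quat_def scalar_prod_def lessThan_atLeast0 intro!: sum.cong)
next
  case (Suc i)
  then have "col (mat_of_cols n (v # unit_vecs n)) j = unit_vec n i"
    using assms v by (subst col_mat_of_cols) (auto simp: unit_vecs_def)
  moreover have "dim_vec v = n" "dim_vec u = n"
    using assms v by auto
  ultimately show ?thesis
    using assms v Suc
    by (subst index_mult_mat_vec) (auto simp: generator_matrix_def quat_def row_transpose unit_vecs_def)
qed

lemma sign_pair:
  assumes "u \<in> carrier_vec n" "j < Suc n"
  shows "sign u (2 * j) = fst (gray (quat u j))" "sign u (2 * j + 1) = snd (gray (quat u j))"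
  using assms by (simp_all add: generated_design_def generated_row Let_def)

lemma sign_cases:
  assumes "u \<in> carrier_vec n" "c < 2 * Suc n"
  shows "sign u c = 1 \<or> sign u c = -1"
  using assms
  by (auto simp: generated_design_def gray_def Let_def)

lemma prod_sign:
  assumes "u \<in> carrier_vec n" "s \<in> words"
  shows "(\<Prod>c\<in>s. sign u c) = (\<Prod>j<Suc n. gray_word (2 * j \<in> s) (2 * j + 1 \<in> s) (quat u j))"
proof -
  have "(\<Prod>c\<in>s. sign u c) = (\<Prod>c<2 * Suc n. if c \<in> s then sign u c else 1)"
    using assms by (subst prod.inter_restrict[symmetric]) (auto simp: Int_absorb1)
  also have "\<dots> = (\<Prod>j<Suc n. gray_word (2 * j \<in> s) (2 * j + 1 \<in> s) (quat u j))"
    unfolding prod_pairs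
    by (rule prod.cong) (use assms in \<open>auto simp: gray_word_def sign_pair[simplified]\<close>)
  finally show ?thesis .
qed

text \<open>Only the two columns from \<open>v\<close> need a complex expression; the other factors
  are real, so \<open>Re\<close> can be taken last. The character turns the inner product of
  \<open>v\<close> and \<open>u\<close> into a product over positions, and the sum over
  \<open>u\<close> then factors.\<close>

lemma char_sum_eq_Re:
  assumes "s \<in> words"
  defines "a \<equiv> twist (0 \<in> s) (1 \<in> s)"
  shows "real_of_int (char_sum s) =
    Re (kappa (0 \<in> s) (1 \<in> s) *
      (\<Prod>i<n. fourier (a * v $ i) (2 * Suc i \<in> s) (2 * Suc i + 1 \<in> s)))"
proof -
  define g where "g i = gray_word (2 * Suc i \<in> s) (2 * Suc i + 1 \<in> s)" for i
  have "real_of_int (\<Prod>c\<in>s. sign u c) =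
      Re (kappa (0 \<in> s) (1 \<in> s) * (\<Prod>i<n. chi (a * v $ i * u $ i) * of_int (g i (u $ i))))"
    if "u \<in> carrier_vec n" for u
  proof -
    have "(\<Prod>c\<in>s. sign u c) =
        gray_word (0 \<in> s) (1 \<in> s) (\<Sum>i<n. v $ i * u $ i) * (\<Prod>i<n. g i (u $ i))"
      using that assms(1)
      by (simp add: prod_sign prod.lessThan_Suc_shift quat_def g_def del: prod.lessThan_Suc)
    moreover have "chi (a * (\<Sum>i<n. v $ i * u $ i)) = (\<Prod>i<n. chi (a * v $ i * u $ i))"
      by (simp add: sum_distrib_left chi_sum mult.assoc)
    moreover have "(\<Prod>i<n. of_int (g i (u $ i)) :: complex)
        = of_real (of_int (\<Prod>i<n. g i (u $ i)))"
      by simp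
    moreover have "Re (x * (y * of_real r)) = Re (x * y) * r" for x y r
      by (simp add: algebra_simps)
    ultimately show ?thesis
      by (simp only: gray_word_eq_Re a_def[symmetric] prod.distrib of_int_mult)
  qed
  then have "real_of_int (char_sum s) = Re (kappa (0 \<in> s) (1 \<in> s) *
      (\<Sum>u\<in>carrier_vec n. \<Prod>i<n. chi (a * v $ i * u $ i) * of_int (g i (u $ i))))"
    by (simp add: char_sum_def sum_distrib_left del: of_int_prod)
  also have "(\<Sum>u\<in>carrier_vec n. \<Prod>i<n. chi (a * v $ i * u $ i) * of_int (g i (u $ i)))
      = (\<Prod>i<n. fourier (a * v $ i) (2 * Suc i \<in> s) (2 * Suc i + 1 \<in> s))"
    unfolding fourier_def g_def by (rule prod_sum_carrier_vec)
  finally show ?thesis .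
qed

text \<open>Modulo 2, the first entry of a row is the sum of its entries at the odd positions of
  \<open>v\<close>. This set consists of both Gray columns of every entry in that relation.\<close>

definition odd_word :: "nat set" where
  "odd_word = {c \<in> {..<2 * Suc n}. c < 2 \<or> v $ (c div 2 - 1) \<in> {1, 3}}"

definition odd_positions :: "nat set" where
  "odd_positions = {i. i < n \<and> v $ i \<in> {1, 3}}"

text \<open>The words that pass the weight condition of \<open>fourier_eq\<close> at every position
  when exactly one column from \<open>v\<close> is taken. The condition is only necessary:
  \<open>char_sum\<close> may still vanish on such a word.\<close>

definition mixed_words :: "nat set set" where
  "mixed_words = {s \<in> words. (0 \<in> s) \<noteq> (1 \<in> s) \<and>
    (\<forall>i<n. of_bool (2 * Suc i \<in> s) + of_bool (2 * Suc i + 1 \<in> s) = gray_weight (v $ i))}"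

lemma odd_word_iff:
  "0 \<in> odd_word" "1 \<in> odd_word"
  "2 * Suc i \<in> odd_word \<longleftrightarrow> i < n \<and> v $ i \<in> {1, 3}"
  "2 * Suc i + 1 \<in> odd_word \<longleftrightarrow> i < n \<and> v $ i \<in> {1, 3}"
  by (auto simp: odd_word_def)

lemma odd_word_in_words: "odd_word \<in> words"
  by (auto simp: odd_word_def)

lemma words_eqI:
  assumes "s \<in> words" "t \<in> words" "0 \<in> s \<longleftrightarrow> 0 \<in> t" "1 \<in> s \<longleftrightarrow> 1 \<in> t"
    and "\<And>i. i < n \<Longrightarrow> (2 * Suc i \<in> s \<longleftrightarrow> 2 * Suc i \<in> t) \<and> (2 * Suc i + 1 \<in> s \<longleftrightarrow> 2 * Suc i + 1 \<in> t)"
  shows "s = t"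
proof (rule Set.set_eqI)
  fix c
  show "c \<in> s \<longleftrightarrow> c \<in> t"
  proof (cases "c < 2 * Suc n")
    case True
    consider "c = 0" | "c = 1" | i where "c = 2 * Suc i" | i where "c = 2 * Suc i + 1"
      by (metis One_nat_def Suc_eq_plus1 evenE mult_0_right not0_implies_Suc oddE)
    then show ?thesis
      using assms(3-5) True by cases auto
  next
    case False
    then show ?thesis using assms(1,2) by auto
  qed
qed

text \<open>The pair from \<open>v\<close> gives the product of \<open>(-1)^(u $ i)\<close> over the
  odd positions \<open>i\<close>, and the pairs at these positions give the same product
  again.\<close>

lemma prod_odd_word:
  assumes "u \<in> carrier_vec n"
  shows "(\<Prod>c\<in>odd_word. sign u c) = 1"
proof -
  have sq: "gray_word True True z * gray_word True True z = 1" for z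
    by (simp add: gray_word_def gray_def)
  have "(\<Prod>c\<in>odd_word. sign u c) = gray_word True True (\<Sum>i<n. v $ i * u $ i) *
      (\<Prod>i<n. if v $ i \<in> {1, 3} then gray_word True True (u $ i) else 1)"
    unfolding prod_sign[OF assms odd_word_in_words] prod.lessThan_Suc_shift
    by (intro arg_cong2[where f = "(*)"] prod.cong)
      (simp_all only: odd_word_iff mult_0_right add_0 quat_def nat.case,
       auto simp: gray_word_def)
  also have "\<dots> = 1"
    by (simp add: gray_word_True_sum gray_word_True_mult prod.distrib[symmetric] sq if_distrib
        cong: if_cong del: insert_iff)
  finally show ?thesis .
qed

text \<open>Common columns occur squared and drop out, so on each run the product over the symmetric
  difference is the product over \<open>s\<close> times that over \<open>odd_word\<close>, which is
  1.\<close>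

lemma char_sum_sym_diff:
  assumes "s \<in> words"
  shows "char_sum (sym_diff s odd_word) = char_sum s"
proof -
  have "(\<Prod>c\<in>sym_diff s odd_word. sign u c) = (\<Prod>c\<in>s. sign u c)" if u: "u \<in> carrier_vec n" for u
  proof -
    have fin: "finite s" "finite odd_word"
      using assms odd_word_in_words finite_subset by auto
    have sq: "(\<Prod>c\<in>s \<inter> odd_word. sign u c) * (\<Prod>c\<in>s \<inter> odd_word. sign u c) = 1"
      unfolding prod.distrib[symmetric]
      by (rule prod.neutral) (use sign_cases[OF u] assms in force)
    have "(\<Prod>c\<in>sym_diff s odd_word. sign u c)
        = (\<Prod>c\<in>s - odd_word. sign u c) * (\<Prod>c\<in>odd_word - s. sign u c)"
      using fin by (intro prod.union_disjoint) auto
    also have "\<dots> = ((\<Prod>c\<in>s - odd_word. sign u c) * (\<Prod>c\<in>s \<inter> odd_word. sign u c))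
        * ((\<Prod>c\<in>odd_word - s. sign u c) * (\<Prod>c\<in>s \<inter> odd_word. sign u c))"
      using sq by (simp add: mult_ac)
    also have "\<dots> = (\<Prod>c\<in>s. sign u c) * (\<Prod>c\<in>odd_word. sign u c)"
      using prod.Int_Diff[OF fin(1), of "sign u" odd_word]
        prod.Int_Diff[OF fin(2), of "sign u" s]
      by (simp add: mult_ac Int_commute)
    finally show ?thesis
      using prod_odd_word[OF u] by simp
  qed
  then show ?thesis by (simp add: char_sum_def)
qed

lemma char_sum_empty: "char_sum {} = 4 ^ n"
  using carrier_vec_finite_card[of n, where 'b = z4] by (simp add: char_sum_def)

lemma char_sum_odd_word: "char_sum odd_word = 4 ^ n"
  using char_sum_sym_diff[of "{}"] char_sum_empty by simp

text \<open>A nonzero product needs the right weight at every position. With no column from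
  \<open>v\<close> the twist is 0 and every weight is 0; with both, \<open>2 * v $ i\<close> is 2 or
  0 according to the parity of \<open>v $ i\<close>; with one, the word is mixed.\<close>

lemma char_sum_nonzero_cases:
  assumes "s \<in> words" "char_sum s \<noteq> 0"
  shows "s = {} \<or> s = odd_word \<or> s \<in> mixed_words"
proof -
  define a where "a = twist (0 \<in> s) (1 \<in> s)"
  have of_bool_add: "(P \<longleftrightarrow> R) \<and> (Q \<longleftrightarrow> R)"
    if "of_bool P + of_bool Q = (if R then 2 else 0 :: nat)" for P Q R
    using that by (cases P; cases Q; simp split: if_splits)
  have weight: "of_bool (2 * Suc i \<in> s) + of_bool (2 * Suc i + 1 \<in> s) = gray_weight (a * v $ i)"
    if "i < n" for i
  proof (rule ccontr)
    assume "\<not> ?thesis"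
    then have "fourier (a * v $ i) (2 * Suc i \<in> s) (2 * Suc i + 1 \<in> s) = 0"
      by (simp add: fourier_eq)
    with that have "(\<Prod>i<n. fourier (a * v $ i) (2 * Suc i \<in> s) (2 * Suc i + 1 \<in> s)) = 0"
      by (auto simp del: mult_Suc_right)
    then have "real_of_int (char_sum s) = 0"
      unfolding char_sum_eq_Re[OF assms(1)] a_def[symmetric]
      by (simp only: mult_zero_right zero_complex.sel)
    with assms(2) show False by simp
  qed
  have mixed: "s \<in> mixed_words" if ne: "(0 \<in> s) \<noteq> (1 \<in> s)"
  proof -
    have "a = 1"
      using ne by (auto simp: a_def twist_def)
    then show ?thesis
      using weight assms(1) ne unfolding mixed_words_def by simp
  qed
  show ?thesis
  proof (cases "0 \<in> s"; cases "1 \<in> s")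
    assume "0 \<notin> s" "1 \<notin> s"
    then have "s = {}"
      using weight assms(1)
      by (intro words_eqI) (auto simp: a_def twist_def gray_weight_def)
    then show ?thesis by simp
  next
    assume 01: "0 \<in> s" "1 \<in> s"
    have "s = odd_word"
    proof (rule words_eqI)
      fix i assume i: "i < n"
      have "gray_weight (a * v $ i) = (if v $ i \<in> {1, 3} then 2 else 0)"
        using 01 by (cases "v $ i" rule: z4_exhaust) (simp_all add: a_def twist_def gray_weight_def)
      then show "(2 * Suc i \<in> s \<longleftrightarrow> 2 * Suc i \<in> odd_word) \<and>
          (2 * Suc i + 1 \<in> s \<longleftrightarrow> 2 * Suc i + 1 \<in> odd_word)"
        using of_bool_add[OF trans[OF weight[OF i]]] i unfolding odd_word_iff by blast
    qed (use assms(1) odd_word_in_words odd_word_iff(1,2) 01 in auto)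
    then show ?thesis by simp
  qed (use mixed in simp_all)
qed

text \<open>Each even entry of \<open>v\<close> contributes a factor 4, each odd one
  \<open>2 * (1 + \<i>)\<close> or \<open>2 * (1 - \<i>)\<close>, and \<open>kappa\<close> one more
  factor of the latter shape without the 2. The real part of the product of these
  \<open>f + 1\<close> Gaussian factors is 0 or \<open>2 ^ ((f + 1) div 2)\<close> up to
  sign.\<close>

lemma abs_char_sum_mixed:
  assumes "s \<in> mixed_words" "char_sum s \<noteq> 0"
  shows "\<bar>char_sum s\<bar> * 2 ^ (card odd_positions div 2) = 4 ^ n"
proof -
  define f where "f = card odd_positions"
  define p where "p i \<longleftrightarrow> 2 * Suc i \<in> s" for i
  \<comment> \<open>The index \<open>n\<close> lies beyond all positions and serves as a slot for
    \<open>kappa\<close>, so that all \<open>f + 1\<close> factors form one product over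
    \<open>insert n odd_positions\<close>.\<close>
  define z where "z i = (if i = n then kappa (0 \<in> s) (1 \<in> s)
    else if p i = (v $ i = 1) then 1 + \<i> else 1 - \<i>)" for i
  have s: "s \<in> words" "(0 \<in> s) \<noteq> (1 \<in> s)" and twist: "twist (0 \<in> s) (1 \<in> s) = 1"
    and weight: "\<And>i. i < n \<Longrightarrow>
      of_bool (2 * Suc i \<in> s) + of_bool (2 * Suc i + 1 \<in> s) = gray_weight (v $ i)"
    using assms by (auto simp: mixed_words_def twist_def)
  have fin: "finite odd_positions" and le: "f \<le> n" and nin: "n \<notin> odd_positions"
    using card_mono[of "{..<n}" odd_positions] by (auto simp: odd_positions_def f_def)
  have "(\<Prod>i<n. fourier (v $ i) (2 * Suc i \<in> s) (2 * Suc i + 1 \<in> s))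
      = (\<Prod>i<n. if i \<in> odd_positions then 2 * z i else 4)"
  proof (rule prod.cong)
    fix i assume "i \<in> {..<n}"
    then show "fourier (v $ i) (2 * Suc i \<in> s) (2 * Suc i + 1 \<in> s)
        = (if i \<in> odd_positions then 2 * z i else 4)"
      unfolding fourier_eq using weight[of i]
      by (cases "v $ i" rule: z4_exhaust) (auto simp: z_def p_def odd_positions_def)
  qed simp
  also have "\<dots> = (\<Prod>i\<in>odd_positions. 2 * z i) * 4 ^ (n - f)"
  proof -
    have "{..<n} \<inter> odd_positions = odd_positions" "{..<n} \<inter> - odd_positions = {..<n} - odd_positions"
      by (auto simp: odd_positions_def)
    moreover have "card ({..<n} - odd_positions) = n - f"
      using fin by (subst card_Diff_subset) (auto simp: odd_positions_def f_def)
    ultimately show ?thesis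
      by (simp add: prod.If_cases)
  qed
  also have "kappa (0 \<in> s) (1 \<in> s) * \<dots> = 2 ^ f * 4 ^ (n - f) * (\<Prod>i\<in>insert n odd_positions. z i)"
    using fin nin by (simp add: prod.distrib f_def z_def mult_ac)
  finally have char_sum: "real_of_int (char_sum s)
      = Re (2 ^ f * 4 ^ (n - f) * (\<Prod>i\<in>insert n odd_positions. z i))"
    by (simp only: char_sum_eq_Re[OF s(1)] twist mult_1_left)
  have z: "z i \<in> {1 + \<i>, 1 - \<i>}" for i
    using s(2) by (auto simp: z_def kappa_def)
  obtain w where w: "w \<in> {1, -1, \<i>, - \<i>}"
    "(\<Prod>i\<in>insert n odd_positions. z i)
      = 2 ^ ((f + 1) div 2) * (if even (f + 1) then w else w * (1 + \<i>))"
    using prod_one_plus_minus_i[of "insert n odd_positions" z] fin nin z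
    unfolding f_def by (metis Suc_eq_plus1 card_insert_disjoint finite_insert)
  define r where "r = Re (if even (f + 1) then w else w * (1 + \<i>))"
  have "real_of_int (char_sum s) = Re (of_real (2 ^ f * 4 ^ (n - f) * 2 ^ ((f + 1) div 2)) *
      (if even (f + 1) then w else w * (1 + \<i>)))"
    unfolding char_sum w(2) by (simp add: mult_ac)
  also have "\<dots> = 2 ^ f * 4 ^ (n - f) * 2 ^ ((f + 1) div 2) * r"
    by (subst times_complex.sel) (simp add: r_def)
  finally have "real_of_int (char_sum s) = 2 ^ f * 4 ^ (n - f) * 2 ^ ((f + 1) div 2) * r" .
  moreover have "r \<in> {0, 1, -1}"
    using w(1) by (auto simp: r_def)
  ultimately have "real_of_int \<bar>char_sum s\<bar> = 2 ^ f * 4 ^ (n - f) * 2 ^ ((f + 1) div 2)"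
    using assms(2) by (auto simp: abs_mult)
  then have "real_of_int (\<bar>char_sum s\<bar> * 2 ^ (f div 2))
      = 2 ^ f * 4 ^ (n - f) * (2 ^ ((f + 1) div 2) * 2 ^ (f div 2))"
    by simp
  \<comment> \<open>For either parity of \<open>f\<close> the two halves add up to
    \<open>f\<close>.\<close>
  also have "(2::real) ^ ((f + 1) div 2) * 2 ^ (f div 2) = 2 ^ f"
    unfolding power_add[symmetric] by (rule arg_cong[where f = "power 2"]) presburger
  also have "(2::real) ^ f * 4 ^ (n - f) * 2 ^ f = 4 ^ n"
  proof -
    have "(4::real) ^ n = 4 ^ f * 4 ^ (n - f)"
      using le by (simp add: power_add[symmetric])
    moreover have "(4::real) ^ f = 2 ^ f * 2 ^ f"
      by (simp add: power_mult_distrib[symmetric])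
    ultimately show ?thesis by simp
  qed
  finally have "real_of_int (\<bar>char_sum s\<bar> * 2 ^ (f div 2)) = real_of_int (4 ^ n)"
    by simp
  then show ?thesis
    unfolding f_def of_int_eq_iff .
qed

section \<open>Parseval's identity and the total weight of the mixed words\<close>

text \<open>The columns from the identity matrix record \<open>u\<close> and the Gray map is
  injective, so distinct runs have distinct rows. Only the \<open>4 ^ n\<close> diagonal pairs
  contribute, each of them \<open>4 ^ Suc n\<close>.\<close>

lemma sum_char_sum_squares: "(\<Sum>s\<in>words. (char_sum s)\<^sup>2) = 4 * 16 ^ n"
proof -
  let ?V = "carrier_vec n :: z4 vec set"
  have fin: "finite ?V" and card: "card ?V = 4 ^ n"
    using carrier_vec_finite_card[of n, where 'b = z4] by auto
  have inner: "(\<Prod>c<2 * Suc n. 1 + sign u c * sign t c) = (if u = t then 4 ^ Suc n else 0)"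
    if "u \<in> ?V" "t \<in> ?V" for u t
  proof (cases "u = t")
    case True
    have "(\<Prod>c<2 * Suc n. 1 + sign u c * sign u c) = (\<Prod>c<2 * Suc n. 2)"
      by (rule prod.cong) (use sign_cases[OF that(1)] in force)+
    also have "\<dots> = 4 ^ Suc n"
      by (simp only: prod_constant card_lessThan power_mult) simp
    finally show ?thesis using True by simp
  next
    case False
    have "\<exists>i<n. u $ i \<noteq> t $ i"
    proof (rule ccontr)
      assume "\<not> ?thesis"
      then have "u = t" using that by (intro eq_vecI) auto
      with False show False by simp
    qed
    then obtain i where i: "i < n" "u $ i \<noteq> t $ i" by blast
    have "gray (u $ i) \<noteq> gray (t $ i)"
      using i by (simp add: gray_eq_iff)
    then have "sign u (2 * Suc i) \<noteq> sign t (2 * Suc i) \<or>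
        sign u (2 * Suc i + 1) \<noteq> sign t (2 * Suc i + 1)"
      using sign_pair[OF that(1), of "Suc i"] sign_pair[OF that(2), of "Suc i"] i
      by (auto simp: prod_eq_iff quat_def)
    then obtain c where c: "c < 2 * Suc n" "sign u c \<noteq> sign t c"
      using i by force
    then have "1 + sign u c * sign t c = 0"
      using sign_cases[OF that(1), of c] sign_cases[OF that(2), of c] by auto
    then have "(\<Prod>c<2 * Suc n. 1 + sign u c * sign t c) = 0"
      using c(1) by (intro prod_zero) auto
    with False show ?thesis by simp
  qed
  have "(\<Sum>s\<in>words. (char_sum s)\<^sup>2) = (\<Sum>u\<in>?V. \<Sum>t\<in>?V. if u = t then 4 ^ Suc n else 0)"
    unfolding char_sum_def sum_squares_walsh[OF finite_lessThan] by (intro sum.cong refl inner)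
  also have "\<dots> = (\<Sum>u\<in>?V. 4 ^ Suc n)"
    using fin by (intro sum.cong) (simp_all add: sum.delta)
  also have "\<dots> = 4 * (4 ^ n * 4 ^ n)"
    by (simp add: card)
  finally show ?thesis
    by (simp add: power_mult_distrib[symmetric])
qed

lemma finite_words: "s \<in> words \<Longrightarrow> finite s"
  by (auto intro: finite_subset)

lemma mixed_words_subset: "mixed_words \<subseteq> words"
  by (auto simp: mixed_words_def)

lemma not_mixed_words: "{} \<notin> mixed_words" "odd_word \<notin> mixed_words"
  using odd_word_iff by (auto simp: mixed_words_def)

lemma finite_mixed_words: "finite mixed_words"
  using mixed_words_subset by (rule finite_subset) simp

text \<open>All other words have sum 0. The predicate \<open>P\<close> will select words by
  membership of the branching column, or by length after its deletion.\<close>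

lemma sum_words_split:
  "(\<Sum>s | s \<in> words \<and> P s. (char_sum s)\<^sup>2) =
    of_bool (P {}) * 16 ^ n + of_bool (P odd_word) * 16 ^ n
      + (\<Sum>s | s \<in> mixed_words \<and> P s. (char_sum s)\<^sup>2)"
proof -
  let ?S = "({s. s = {} \<and> P s} \<union> {s. s = odd_word \<and> P s}) \<union> {s. s \<in> mixed_words \<and> P s}"
  have sq: "((4::int) ^ n)\<^sup>2 = 16 ^ n"
    using power_mult[of "4::int" n 2] power_mult[of "4::int" 2 n]
    by (simp add: mult.commute)
  have single: "(\<Sum>s | s = t \<and> P s. (char_sum s)\<^sup>2) = of_bool (P t) * (char_sum t)\<^sup>2" for t
  proof -
    have "{s. s = t \<and> P s} = (if P t then {t} else {})"
      by auto
    then show ?thesis by simp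
  qed
  have "(\<Sum>s | s \<in> words \<and> P s. (char_sum s)\<^sup>2) = (\<Sum>s\<in>?S. (char_sum s)\<^sup>2)"
  proof (rule sum.mono_neutral_right)
    show "?S \<subseteq> {s. s \<in> words \<and> P s}"
      using odd_word_in_words mixed_words_subset by blast
    show "\<forall>s\<in>{s. s \<in> words \<and> P s} - ?S. (char_sum s)\<^sup>2 = 0"
      using char_sum_nonzero_cases by auto
  qed simp
  also have "\<dots> = (\<Sum>s | s = {} \<and> P s. (char_sum s)\<^sup>2) + (\<Sum>s | s = odd_word \<and> P s. (char_sum s)\<^sup>2)
      + (\<Sum>s | s \<in> mixed_words \<and> P s. (char_sum s)\<^sup>2)"
  proof -
    have "{s. s = {} \<and> P s} \<inter> {s. s = odd_word \<and> P s} = {}"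
      using odd_word_iff by auto
    moreover have "({s. s = {} \<and> P s} \<union> {s. s = odd_word \<and> P s}) \<inter> {s. s \<in> mixed_words \<and> P s} = {}"
      using not_mixed_words by auto
    ultimately show ?thesis
      using finite_mixed_words by (simp add: sum.union_disjoint)
  qed
  finally show ?thesis
    by (simp only: single char_sum_empty char_sum_odd_word sq)
qed

lemma sum_mixed_words: "(\<Sum>s\<in>mixed_words. (char_sum s)\<^sup>2) = 2 * 16 ^ n"
  using sum_words_split[of "\<lambda>_. True"] sum_char_sum_squares by (simp add: Pow_def)

text \<open>Symmetric difference with \<open>odd_word\<close> preserves \<open>char_sum\<close> and
  toggles \<open>b\<close>. It exchanges the empty word and \<open>odd_word\<close>, whose equal
  contributions cancel, so the mixed words split evenly.\<close>

lemma sum_mixed_words_odd: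
  assumes "b \<in> odd_word"
  shows "(\<Sum>s | s \<in> mixed_words \<and> b \<in> s. (char_sum s)\<^sup>2) = 16 ^ n"
    and "(\<Sum>s | s \<in> mixed_words \<and> b \<notin> s. (char_sum s)\<^sup>2) = 16 ^ n"
proof -
  have "(\<Sum>s | s \<in> words \<and> b \<in> s. (char_sum s)\<^sup>2) = (\<Sum>s | s \<in> words \<and> b \<notin> s. (char_sum s)\<^sup>2)"
    using assms odd_word_in_words char_sum_sym_diff
    by (intro sum.reindex_bij_witness[where i = "\<lambda>s. sym_diff s odd_word"
          and j = "\<lambda>s. sym_diff s odd_word"]) auto
  then have "(\<Sum>s | s \<in> mixed_words \<and> b \<in> s. (char_sum s)\<^sup>2)
      = (\<Sum>s | s \<in> mixed_words \<and> b \<notin> s. (char_sum s)\<^sup>2)"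
    using sum_words_split[of "\<lambda>s. b \<in> s"] sum_words_split[of "\<lambda>s. b \<notin> s"] assms by simp
  moreover have "(\<Sum>s | s \<in> mixed_words \<and> b \<in> s. (char_sum s)\<^sup>2)
      + (\<Sum>s | s \<in> mixed_words \<and> b \<notin> s. (char_sum s)\<^sup>2) = 2 * 16 ^ n"
    unfolding sum_mixed_words[symmetric]
    using finite_mixed_words
    by (subst sum.union_disjoint[symmetric]) (auto intro!: sum.cong)
  ultimately show "(\<Sum>s | s \<in> mixed_words \<and> b \<in> s. (char_sum s)\<^sup>2) = 16 ^ n"
    "(\<Sum>s | s \<in> mixed_words \<and> b \<notin> s. (char_sum s)\<^sup>2) = 16 ^ n"
    by auto
qed

section \<open>Lengths of the words in terms of the frequencies of \<open>v\<close>\<close>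

lemma mixed_word_weight:
  assumes "s \<in> mixed_words" "i < n"
  shows "of_bool (2 * Suc i \<in> s) + of_bool (2 * Suc i + 1 \<in> s) = gray_weight (v $ i)"
  using assms unfolding mixed_words_def by blast

text \<open>Weight 0 excludes both columns of a position and weight 2 requires both.\<close>

lemma mixed_word_associated:
  assumes "s \<in> mixed_words"
  shows "associated v b 0 \<Longrightarrow> b \<notin> s" and "associated v b 2 \<Longrightarrow> b \<in> s"
proof -
  have weight: "\<exists>i. b \<in> {2 * Suc i, 2 * Suc i + 1} \<and>
      of_bool (2 * Suc i \<in> s) + of_bool (2 * Suc i + 1 \<in> s) = gray_weight z"
    if "associated v b z" for z
  proof -
    obtain i where i: "i < n" "v $ i = z" "b \<in> {2 * Suc i, 2 * Suc i + 1}"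
      using \<open>associated v b z\<close> v by (auto simp: associated_def)
    with mixed_word_weight[OF assms i(1)] show ?thesis
      by blast
  qed
  show "b \<notin> s" if "associated v b 0"
    using weight[OF that] by (auto simp: gray_weight_def)
  show "b \<in> s" if b: "associated v b 2"
  proof -
    obtain i where i: "b \<in> {2 * Suc i, 2 * Suc i + 1}"
      "of_bool (2 * Suc i \<in> s) + of_bool (2 * Suc i + 1 \<in> s) = (2::nat)"
      using weight[OF b] by (auto simp: gray_weight_def)
    then show ?thesis
      by (cases "2 * Suc i \<in> s"; cases "2 * Suc i + 1 \<in> s"; auto)
  qed
qed

lemma freq_eq_sum: "freq v a = (\<Sum>i<n. of_bool (v $ i = a))"
  using v by (simp add: freq_def sum.If_cases of_bool_def Int_def)

lemma card_odd_positions: "card odd_positions = freq v 1 + freq v 3"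
proof -
  have "odd_positions = {i. i < dim_vec v \<and> v $ i = 1} \<union> {i. i < dim_vec v \<and> v $ i = 3}"
    using v by (auto simp: odd_positions_def)
  moreover have "{i. i < dim_vec v \<and> v $ i = 1} \<inter> {i. i < dim_vec v \<and> v $ i = 3} = {}"
    by auto
  ultimately show ?thesis
    unfolding freq_def by (simp add: card_Un_disjoint)
qed

lemma freq_total: "freq v 0 + freq v 1 + freq v 2 + freq v 3 = n"
proof -
  have "(\<Sum>i<n. 1) = (\<Sum>i<n. of_bool (v $ i = 0) + of_bool (v $ i = 1) + of_bool (v $ i = 2)
      + of_bool (v $ i = 3) :: nat)"
  proof (rule sum.cong)
    fix i
    show "1 = (of_bool (v $ i = 0) + of_bool (v $ i = 1) + of_bool (v $ i = 2)
        + of_bool (v $ i = 3) :: nat)"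
      by (cases "v $ i" rule: z4_exhaust) simp_all
  qed simp
  then show ?thesis
    by (simp add: freq_eq_sum sum.distrib)
qed

lemma card_word:
  assumes "s \<in> words"
  shows "card s = of_bool (0 \<in> s) + of_bool (1 \<in> s)
    + (\<Sum>i<n. of_bool (2 * Suc i \<in> s) + of_bool (2 * Suc i + 1 \<in> s))"
proof -
  have "card s = (\<Sum>c<2 * Suc n. of_bool (c \<in> s))"
  proof -
    have "(\<Sum>c<m. of_bool (c \<in> s)) = card ({..<m} \<inter> s)" for m
      by (simp add: of_bool_def sum.If_cases)
    moreover have "{..<2 * Suc n} \<inter> s = s"
      using assms by auto
    ultimately show ?thesis by metis
  qed
  also have "\<dots> = (\<Sum>j<Suc n. of_bool (2 * j \<in> s) + of_bool (2 * j + 1 \<in> s))"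
    by (rule sum_pairs)
  finally show ?thesis
    by (simp add: sum.lessThan_Suc_shift del: sum.lessThan_Suc)
qed

text \<open>One column from \<open>v\<close>, plus the Lee weight of \<open>v\<close>.\<close>

lemma card_mixed_word:
  assumes "s \<in> mixed_words"
  shows "card s = Suc (freq v 1 + freq v 3 + 2 * freq v 2)"
proof -
  have s: "s \<in> words" "(0 \<in> s) \<noteq> (1 \<in> s)"
    and weight: "\<And>i. i < n \<Longrightarrow>
      of_bool (2 * Suc i \<in> s) + of_bool (2 * Suc i + 1 \<in> s) = gray_weight (v $ i)"
    using assms by (auto simp: mixed_words_def)
  have "gray_weight a = of_bool (a = 1) + of_bool (a = 3) + 2 * of_bool (a = 2)" for a
    by (cases a rule: z4_exhaust) (auto simp: gray_weight_def)
  then have "(\<Sum>i<n. of_bool (2 * Suc i \<in> s) + of_bool (2 * Suc i + 1 \<in> s))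
      = freq v 1 + freq v 3 + 2 * freq v 2"
    using weight by (simp add: freq_eq_sum sum.distrib sum_distrib_left del: mult_Suc_right)
  then show ?thesis
    using card_word[OF s(1)] s(2) by auto
qed

lemma card_odd_word: "card odd_word = 2 * (freq v 1 + freq v 3) + 2"
proof -
  have "(\<Sum>i<n. of_bool (2 * Suc i \<in> odd_word) + of_bool (2 * Suc i + 1 \<in> odd_word))
      = (\<Sum>i<n. 2 * (of_bool (v $ i = 1) + of_bool (v $ i = 3)) :: nat)"
    unfolding odd_word_iff by (rule sum.cong) auto
  then show ?thesis
    using card_word[OF odd_word_in_words] odd_word_iff(1,2)
    by (simp add: freq_eq_sum sum.distrib sum_distrib_left[symmetric])
qed

section \<open>Wordlengths and maximal correlations of a half-fraction\<close>

text \<open>The columns from \<open>v\<close> and those at odd entries all lie in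
  \<open>odd_word\<close>, so they form a single case.\<close>

lemma half_fraction_exhaust:
  assumes "half_fraction (generated_design v) b E"
  obtains "b \<in> odd_word" | "associated v b 0" | "associated v b 2"
proof -
  have b: "b < 2 * Suc n"
    using assms v by (auto simp: half_fraction_def generated_design_def)
  show ?thesis
  proof (cases "b < 2")
    case True
    then show ?thesis using b that(1) by (auto simp: odd_word_def)
  next
    case False
    define i where "i = b div 2 - 1"
    have i: "i < n" "b \<in> {2 * (i + 1), 2 * (i + 1) + 1}"
      using False b by (auto simp: i_def)
    show ?thesis
    proof (cases "v $ i" rule: z4_exhaust)
      case 1
      with i v show ?thesis by (intro that(2)) (auto simp: associated_def)
    next
      case 3
      with i v show ?thesis by (intro that(3)) (auto simp: associated_def)
    qed (use b that(1) in \<open>auto simp: odd_word_def i_def\<close>)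
  qed
qed

lemma associated_1_odd_word: "associated v b 1 \<Longrightarrow> b \<in> odd_word"
  using v by (auto simp: associated_def odd_word_def)

text \<open>On signs, twice the indicator of \<open>sign u b = x\<close> is
  \<open>1 + x * sign u b\<close>. So twice a sum over the kept runs is the full sum plus
  \<open>x\<close> times the sum with column \<open>b\<close> adjoined. Balance of \<open>b\<close>
  says that \<open>char_sum {b}\<close> vanishes, which makes the number of kept runs half of
  \<open>4 ^ n\<close>.\<close>

lemma
  assumes "half_fraction (generated_design v) b E"
  shows half_fraction_branch: "b < 2 * Suc n"
    and half_fraction_char_sum: "char_sum {b} = 0"
    and half_fraction_factors: "factors E = {..<2 * Suc n} - {b}"
    and half_fraction_rho:
      "\<exists>x\<in>{1, -1}. \<forall>s. finite s \<longrightarrow> b \<notin> s \<longrightarrow>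
        rho E s = \<bar>real_of_int (char_sum s + x * char_sum (insert b s))\<bar> / 4 ^ n"
proof -
  let ?V = "carrier_vec n :: z4 vec set"
  have fin: "finite ?V" and card: "card ?V = 4 ^ n"
    using carrier_vec_finite_card[of n, where 'b = z4] by auto
  have runs: "runs (generated_design v) = ?V"
    and factors: "factors (generated_design v) = {..<2 * Suc n}"
    using v by (auto simp: generated_design_def)
  obtain x where x: "x \<in> {1, -1}" "E = \<lparr>runs = {u \<in> ?V. sign u b = x},
      factors = {..<2 * Suc n} - {b}, entry = sign\<rparr>"
    and b: "b < 2 * Suc n" and balanced: "balanced (generated_design v) b"
    using assms unfolding half_fraction_def runs factors by auto
  show "b < 2 * Suc n" by (rule b)
  show "factors E = {..<2 * Suc n} - {b}" by (simp add: x)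
  have "char_sum {b} = (\<Sum>u\<in>?V. of_bool (sign u b = 1) - of_bool (sign u b = -1))"
    unfolding char_sum_def by (rule sum.cong) (use sign_cases b in force)+
  also have "\<dots> = int (card {u \<in> ?V. sign u b = 1}) - int (card {u \<in> ?V. sign u b = -1})"
    using fin by (simp add: sum_subtractf of_bool_def sum.If_cases Int_def)
  finally show zero: "char_sum {b} = 0"
    using balanced by (simp add: balanced_def runs)
  have half: "2 * (\<Sum>u\<in>runs E. h u) = (\<Sum>u\<in>?V. h u) + x * (\<Sum>u\<in>?V. sign u b * h u)"
    for h :: "z4 vec \<Rightarrow> int"
  proof -
    have "2 * (\<Sum>u\<in>runs E. h u) = (\<Sum>u\<in>?V. 2 * (if sign u b = x then h u else 0))"
      using fin by (simp add: x sum.inter_filter sum_distrib_left)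
    also have "\<dots> = (\<Sum>u\<in>?V. h u + x * (sign u b * h u))"
      by (rule sum.cong) (use sign_cases b x(1) in force)+
    finally show ?thesis
      by (simp add: sum.distrib sum_distrib_left)
  qed
  have card_runs: "2 * int (card (runs E)) = 4 ^ n"
    using half[of "\<lambda>_. 1"] zero card by (simp add: char_sum_def)
  have "rho E s = \<bar>real_of_int (char_sum s + x * char_sum (insert b s))\<bar> / 4 ^ n"
    if "finite s" "b \<notin> s" for s
  proof -
    have "2 * (\<Sum>u\<in>runs E. \<Prod>c\<in>s. entry E u c) = char_sum s + x * char_sum (insert b s)"
      using half[of "\<lambda>u. \<Prod>c\<in>s. sign u c"] that x by (simp add: char_sum_def)
    moreover have "2 * real (card (runs E)) = 4 ^ n"
      using card_runs by (metis of_int_mult of_int_numeral of_int_of_nat_eq of_int_power)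
    moreover have "rho E s = \<bar>real_of_int (2 * (\<Sum>u\<in>runs E. \<Prod>c\<in>s. entry E u c))\<bar>
        / (2 * real (card (runs E)))"
      by (simp add: rho_def abs_mult)
    ultimately show ?thesis by simp
  qed
  with x(1) show "\<exists>x\<in>{1, -1}. \<forall>s. finite s \<longrightarrow> b \<notin> s \<longrightarrow>
        rho E s = \<bar>real_of_int (char_sum s + x * char_sum (insert b s))\<bar> / 4 ^ n"
    by blast
qed

text \<open>
  No two words of nonzero weight are identified in a half-fraction.
\<close>

lemma char_sum_insert:
  assumes "s \<in> words" "b < 2 * Suc n" "b \<notin> s" "char_sum {b} = 0"
  shows "char_sum s = 0 \<or> char_sum (insert b s) = 0"
proof (rule ccontr)
  assume contra: "\<not> ?thesis"
  then have "s \<noteq> {}"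
    using assms by auto
  have insert: "insert b s \<in> words"
    using assms by auto
  consider "s = odd_word" "insert b s \<in> mixed_words" | "s \<in> mixed_words" "insert b s = odd_word"
    | "s \<in> mixed_words" "insert b s \<in> mixed_words"
    using char_sum_nonzero_cases[OF assms(1)] char_sum_nonzero_cases[OF insert] contra
      \<open>s \<noteq> {}\<close> assms(3) by auto
  then show False
  proof cases
    case 1
    then show ?thesis using odd_word_iff(1,2) by (auto simp: mixed_words_def)
  next
    case 2
    \<comment> \<open>The two words differ only in \<open>b\<close>, so the relation
      \<open>odd_word\<close> carries \<open>s\<close> to \<open>{b}\<close>, whose sum vanishes by
      balance.\<close>
    then have "s = odd_word - {b}" using assms(3) by auto
    then have "sym_diff s odd_word = {b}"
      using 2 assms(3) by auto
    then show ?thesis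
      using char_sum_sym_diff[OF assms(1)] assms(4) contra by simp
  next
    case 3
    then have "card (insert b s) = card s"
      by (simp add: card_mixed_word)
    then show ?thesis
      using assms(3) finite_words[OF assms(1)] by simp
  qed
qed

text \<open>By \<open>char_sum_insert\<close> at most one of the two sums is nonzero, so absolute
  values and squares add for either kept symbol.\<close>

lemma half_fraction_rho_word:
  assumes "half_fraction (generated_design v) b E" "s \<in> words" "b \<notin> s"
  shows "rho E s = real_of_int (\<bar>char_sum s\<bar> + \<bar>char_sum (insert b s)\<bar>) / 4 ^ n"
    and "(rho E s)\<^sup>2 = real_of_int ((char_sum s)\<^sup>2 + (char_sum (insert b s))\<^sup>2) / 16 ^ n"
proof -
  obtain x :: int where x: "x \<in> {1, -1}"
    "rho E s = \<bar>real_of_int (char_sum s + x * char_sum (insert b s))\<bar> / 4 ^ n"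
    using half_fraction_rho[OF assms(1)] finite_words[OF assms(2)] assms(3) by blast
  have zero: "char_sum s = 0 \<or> char_sum (insert b s) = 0"
    using char_sum_insert[OF assms(2) half_fraction_branch[OF assms(1)] assms(3)
        half_fraction_char_sum[OF assms(1)]] .
  show rho: "rho E s = real_of_int (\<bar>char_sum s\<bar> + \<bar>char_sum (insert b s)\<bar>) / 4 ^ n"
    using x zero by auto
  have sq: "((4::real) ^ n)\<^sup>2 = 16 ^ n"
    using power_mult[of "4::real" n 2] power_mult[of "4::real" 2 n] by (simp add: mult.commute)
  show "(rho E s)\<^sup>2 = real_of_int ((char_sum s)\<^sup>2 + (char_sum (insert b s))\<^sup>2) / 16 ^ n"
    unfolding rho power_divide sq using zero by auto
qed

lemma half_fraction_factor_subsets: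
  assumes "half_fraction (generated_design v) b E"
  shows "factor_subsets E j = {s. s \<in> words \<and> b \<notin> s \<and> card s = j}"
  using half_fraction_factors[OF assms] by (auto simp: factor_subsets_def)

text \<open>A set \<open>s\<close> of remaining factors collects the two words \<open>s\<close> and
  \<open>insert b s\<close> of the full design; the sum is regrouped by these words.\<close>

lemma half_fraction_wordlength_eq_sum:
  assumes "half_fraction (generated_design v) b E"
  shows "wordlength E j =
    real_of_int (\<Sum>t | t \<in> words \<and> card (t - {b}) = j. (char_sum t)\<^sup>2) / 16 ^ n"
proof -
  let ?A = "factor_subsets E j"
  note A = half_fraction_factor_subsets[OF assms]
  have fin: "finite ?A"
    unfolding A by (rule finite_subset[of _ words]) auto
  have "{t. t \<in> words \<and> card (t - {b}) = j} = ?A \<union> insert b ` ?A" (is "?T = _")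
  proof (intro equalityI subsetI)
    fix t assume t: "t \<in> ?T"
    show "t \<in> ?A \<union> insert b ` ?A"
    proof (cases "b \<in> t")
      case True
      then have "t = insert b (t - {b})" by auto
      moreover have "t - {b} \<in> ?A" using t unfolding A by auto
      ultimately show ?thesis by blast
    next
      case False
      then show ?thesis using t unfolding A by auto
    qed
  next
    fix t assume "t \<in> ?A \<union> insert b ` ?A"
    then show "t \<in> ?T"
      using half_fraction_branch[OF assms] unfolding A by auto
  qed
  moreover have "?A \<inter> insert b ` ?A = {}"
    unfolding A by auto
  moreover have "inj_on (insert b) ?A"
    unfolding A by (rule inj_onI) (auto simp: insert_ident)
  ultimately have "(\<Sum>t\<in>?T. (char_sum t)\<^sup>2)
      = (\<Sum>s\<in>?A. (char_sum s)\<^sup>2 + (char_sum (insert b s))\<^sup>2)"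
    using fin by (simp add: sum.union_disjoint sum.reindex sum.distrib)
  moreover have "wordlength E j
      = (\<Sum>s\<in>?A. real_of_int ((char_sum s)\<^sup>2 + (char_sum (insert b s))\<^sup>2) / 16 ^ n)"
    unfolding wordlength_def
    by (rule sum.cong) (use half_fraction_rho_word(2)[OF assms] A in auto)
  ultimately show ?thesis
    by (simp add: sum_divide_distrib)
qed

text \<open>A mixed word becomes shorter by one exactly when it contains \<open>b\<close>. The bound
  \<open>1 \<le> j\<close> keeps out the empty word.\<close>

lemma half_fraction_wordlength:
  assumes "half_fraction (generated_design v) b E" "1 \<le> j"
  shows "wordlength E j = of_bool (j = card (odd_word - {b}))
    + real_of_int (\<Sum>t | t \<in> mixed_words \<and> b \<in> t. (char_sum t)\<^sup>2) / 16 ^ n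
        * of_bool (j = freq v 1 + freq v 3 + 2 * freq v 2)
    + real_of_int (\<Sum>t | t \<in> mixed_words \<and> b \<notin> t. (char_sum t)\<^sup>2) / 16 ^ n
        * of_bool (j = freq v 1 + freq v 3 + 2 * freq v 2 + 1)"
proof -
  let ?L = "freq v 1 + freq v 3 + 2 * freq v 2"
  have card: "card (t - {b}) = (if b \<in> t then ?L else ?L + 1)" if "t \<in> mixed_words" for t
  proof -
    have "finite t"
      using that mixed_words_subset finite_words by blast
    then show ?thesis
      using card_mixed_word[OF that] by simp
  qed
  have "(\<Sum>t | t \<in> mixed_words \<and> card (t - {b}) = j. (char_sum t)\<^sup>2)
      = (\<Sum>t\<in>mixed_words. of_bool (b \<in> t) * (of_bool (j = ?L) * (char_sum t)\<^sup>2)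
          + of_bool (b \<notin> t) * (of_bool (j = ?L + 1) * (char_sum t)\<^sup>2))"
    unfolding sum.inter_filter[OF finite_mixed_words]
    by (rule sum.cong) (use card in auto)
  also have "\<dots> = of_bool (j = ?L) * (\<Sum>t | t \<in> mixed_words \<and> b \<in> t. (char_sum t)\<^sup>2)
      + of_bool (j = ?L + 1) * (\<Sum>t | t \<in> mixed_words \<and> b \<notin> t. (char_sum t)\<^sup>2)"
    unfolding sum.inter_filter[OF finite_mixed_words] sum_distrib_left sum.distrib[symmetric]
    by (rule sum.cong) auto
  finally show ?thesis
    unfolding half_fraction_wordlength_eq_sum[OF assms(1)] sum_words_split
    using assms(2) by (auto simp: add_divide_distrib)
qed

text \<open>On nonempty sets \<open>rho\<close> takes only the values 0, 1 and
  \<open>1 / 2 ^ ((freq v 1 + freq v 3) div 2)\<close>. The value 1 is attained at what remains of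
  \<open>odd_word\<close>; at any other length, \<open>wordlength\<close> tells whether the maximum
  is 0.\<close>

lemma half_fraction_max_rho:
  assumes hf: "half_fraction (generated_design v) b E" and j: "j \<in> {1..2 * n + 1}"
  shows "max_rho E j =
    (if j = card (odd_word - {b}) then 1 else if wordlength E j = 0 then 0
     else 1 / 2 ^ ((freq v 1 + freq v 3) div 2))"
proof -
  let ?A = "factor_subsets E j" and ?h = "(freq v 1 + freq v 3) div 2"
  note A = half_fraction_factor_subsets[OF hf]
  note b = half_fraction_branch[OF hf]
  have fin: "finite ?A"
    unfolding A by (rule finite_subset[of _ words]) auto
  \<comment> \<open>Ensures that \<open>Max\<close> is taken over a nonempty set.\<close>
  have ne: "?A \<noteq> {}"
  proof -
    have "j \<le> card (factors E)"
      using half_fraction_factors[OF hf] b j by simp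
    then show ?thesis
      unfolding factor_subsets_def using obtain_subset_with_card_n by blast
  qed
  have word: "char_sum t = 0 \<or> t = odd_word \<and> real_of_int \<bar>char_sum t\<bar> / 4 ^ n = 1
      \<or> real_of_int \<bar>char_sum t\<bar> / 4 ^ n = 1 / 2 ^ ?h"
    if "t \<in> words" "t \<noteq> {}" for t
  proof (cases "t \<in> mixed_words \<and> char_sum t \<noteq> 0")
    case True
    then have "real_of_int (\<bar>char_sum t\<bar> * 2 ^ ?h) = real_of_int (4 ^ n)"
      using abs_char_sum_mixed[of t] unfolding card_odd_positions by simp
    then show ?thesis by (simp add: field_simps)
  next
    case False
    then show ?thesis
      using char_sum_nonzero_cases[OF that(1)] that(2) char_sum_odd_word by auto
  qed
  have rho_value: "rho E s = 0 \<or> s = odd_word - {b} \<and> rho E s = 1 \<or> rho E s = 1 / 2 ^ ?h"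
    if "s \<in> ?A" for s
  proof -
    have s: "s \<in> words" "b \<notin> s" "s \<noteq> {}" and ins: "insert b s \<in> words"
      using that j b unfolding A by auto
    note rho = half_fraction_rho_word(1)[OF hf s(1,2)]
    show ?thesis
    proof (cases "char_sum s = 0")
      case True
      have "insert b s = odd_word \<Longrightarrow> s = odd_word - {b}"
        using s(2) by auto
      with True show ?thesis
        using word[OF ins] unfolding rho by auto
    next
      case False
      then have "char_sum (insert b s) = 0"
        using char_sum_insert[OF s(1) b s(2) half_fraction_char_sum[OF hf]] by simp
      moreover have "s = odd_word \<Longrightarrow> s = odd_word - {b}"
        using s(2) by auto
      ultimately show ?thesis
        using word[OF s(1,3)] unfolding rho by auto
    qed
  qed
  show ?thesis
  proof (cases "j = card (odd_word - {b})")
    case True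
    let ?s = "odd_word - {b}"
    have s: "?s \<in> words" "b \<notin> ?s"
      using odd_word_in_words by auto
    have "rho E ?s = 1"
    proof (cases "b \<in> odd_word")
      case True
      then have "insert b ?s = odd_word" by auto
      then show ?thesis
        using char_sum_insert[OF s(1) b s(2) half_fraction_char_sum[OF hf]] char_sum_odd_word
        unfolding half_fraction_rho_word(1)[OF hf s] by auto
    next
      case False
      then have "?s = odd_word" by auto
      then show ?thesis
        using char_sum_insert[OF s(1) b s(2) half_fraction_char_sum[OF hf]] char_sum_odd_word
        unfolding half_fraction_rho_word(1)[OF hf s] by auto
    qed
    moreover have "?s \<in> ?A"
      using s True unfolding A by auto
    moreover have "rho E s \<le> 1" if "s \<in> ?A" for s
      using rho_value[OF that] by (auto simp: divide_le_eq_1)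
    ultimately have "max_rho E j = 1"
      unfolding max_rho_def using fin by (intro Max_eqI) force+
    with True show ?thesis by simp
  next
    case False
    have vals: "rho E s = 0 \<or> rho E s = 1 / 2 ^ ?h" if "s \<in> ?A" for s
      using rho_value[OF that] that False unfolding A by auto
    have zero: "wordlength E j = 0 \<longleftrightarrow> (\<forall>s\<in>?A. rho E s = 0)"
      unfolding wordlength_def using fin by (simp add: sum_nonneg_eq_0_iff)
    show ?thesis
    proof (cases "wordlength E j = 0")
      case True
      then have "rho E ` ?A = {0}"
        using zero ne by auto
      then show ?thesis
        using True False by (simp add: max_rho_def)
    next
      case nonzero: False
      then obtain s where "s \<in> ?A" "rho E s = 1 / 2 ^ ?h"
        using zero vals by blast
      then have "max_rho E j = 1 / 2 ^ ?h"
        unfolding max_rho_def using fin vals by (intro Max_eqI) force+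
      then show ?thesis
        using nonzero False by simp
    qed
  qed
qed

end

section \<open>The three possible profiles of a half-fraction\<close>

text \<open>
  Here \<open>w\<close> is the length of \<open>odd_word\<close> after deletion of the branching column, and \<open>p\<close> and
  \<open>q\<close> are the total squared weights of the mixed words that do and do not contain that column.
\<close>

definition has_profile ::
  "nat \<Rightarrow> nat \<Rightarrow> nat \<Rightarrow> nat \<Rightarrow> real \<Rightarrow> real \<Rightarrow> 'r design \<Rightarrow> bool" where
  "has_profile n f g w p q E \<longleftrightarrow>
    card (factors E) = 2 * n + 1 \<and>
    (\<forall>j\<in>{1..2 * n + 1}.
      wordlength E j = of_bool (j = w) + p * of_bool (j = f + 2 * g)
        + q * of_bool (j = f + 2 * g + 1) \<and>
      max_rho E j =
        (if j = w then 1 else if wordlength E j = 0 then 0 else 1 / 2 ^ (f div 2)))"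

lemma has_profileD:
  assumes "has_profile n f g w p q E"
  shows "card (factors E) = 2 * n + 1"
    and "j \<in> {1..2 * n + 1} \<Longrightarrow> wordlength E j =
      of_bool (j = w) + p * of_bool (j = f + 2 * g) + q * of_bool (j = f + 2 * g + 1)"
    and "j \<in> {1..2 * n + 1} \<Longrightarrow> max_rho E j =
      (if j = w then 1 else if wordlength E j = 0 then 0 else 1 / 2 ^ (f div 2))"
  using assms unfolding has_profile_def by blast+

context quaternary_code
begin

lemma half_fraction_has_profile:
  assumes hf: "half_fraction (generated_design v) b E"
    and "real_of_int (\<Sum>t | t \<in> mixed_words \<and> b \<in> t. (char_sum t)\<^sup>2) / 16 ^ n = p"
    and "real_of_int (\<Sum>t | t \<in> mixed_words \<and> b \<notin> t. (char_sum t)\<^sup>2) / 16 ^ n = q"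
  shows "has_profile n (freq v 1 + freq v 3) (freq v 2) (card (odd_word - {b})) p q E"
proof -
  have "card (factors E) = 2 * n + 1"
    using half_fraction_factors[OF hf] half_fraction_branch[OF hf] by simp
  then show ?thesis
    unfolding has_profile_def using half_fraction_wordlength[OF hf] half_fraction_max_rho[OF hf]
    by (simp only: assms(2,3)) simp
qed

lemma has_profile_odd:
  assumes "half_fraction (generated_design v) b E" "b \<in> odd_word"
  shows "has_profile n (freq v 1 + freq v 3) (freq v 2) (2 * (freq v 1 + freq v 3) + 1) 1 1 E"
proof -
  have "card (odd_word - {b}) = 2 * (freq v 1 + freq v 3) + 1"
    using card_odd_word assms(2) finite_words[OF odd_word_in_words] by simp
  then show ?thesis
    using half_fraction_has_profile[OF assms(1) refl refl] sum_mixed_words_odd[OF assms(2)]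
    by simp
qed

lemma associated_even_notin_odd_word:
  assumes "associated v b z" "z \<notin> {1, 3}"
  shows "b \<notin> odd_word"
proof -
  obtain i where "i < n" "v $ i = z" "b = 2 * Suc i \<or> b = 2 * Suc i + 1"
    using assms(1) v by (auto simp: associated_def)
  then show ?thesis
    using odd_word_iff(3,4)[of i] assms(2) by metis
qed

lemma associated_freq:
  assumes "associated v b z"
  shows "1 \<le> freq v z"
proof -
  obtain i where "i \<in> {i. i < dim_vec v \<and> v $ i = z}"
    using assms by (auto simp: associated_def)
  then have "card {i. i < dim_vec v \<and> v $ i = z} \<noteq> 0"
    by (subst card_0_eq) auto
  then show ?thesis
    unfolding freq_def by linarith
qed

lemma has_profile_0:
  assumes "half_fraction (generated_design v) b E" "associated v b 0"
  shows "has_profile n (freq v 1 + freq v 3) (freq v 2) (2 * (freq v 1 + freq v 3) + 2) 0 2 E"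
proof -
  have odd: "odd_word - {b} = odd_word"
    using associated_even_notin_odd_word[OF assms(2)] by simp
  have sets: "{t. t \<in> mixed_words \<and> b \<in> t} = {}"
    "{t. t \<in> mixed_words \<and> b \<notin> t} = mixed_words"
    using mixed_word_associated(1) assms(2) by blast+
  have "real_of_int (\<Sum>t | t \<in> mixed_words \<and> b \<in> t. (char_sum t)\<^sup>2) / 16 ^ n = 0"
    "real_of_int (\<Sum>t | t \<in> mixed_words \<and> b \<notin> t. (char_sum t)\<^sup>2) / 16 ^ n = 2"
    unfolding sets sum_mixed_words by simp_all
  note profile = half_fraction_has_profile[OF assms(1) this]
  show ?thesis
    using profile unfolding odd card_odd_word .
qed

lemma has_profile_2:
  assumes "half_fraction (generated_design v) b E" "associated v b 2"
  shows "has_profile n (freq v 1 + freq v 3) (freq v 2) (2 * (freq v 1 + freq v 3) + 2) 2 0 E"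
proof -
  have odd: "odd_word - {b} = odd_word"
    using associated_even_notin_odd_word[OF assms(2)] by simp
  have sets: "{t. t \<in> mixed_words \<and> b \<in> t} = mixed_words"
    "{t. t \<in> mixed_words \<and> b \<notin> t} = {}"
    using mixed_word_associated(2) assms(2) by blast+
  have "real_of_int (\<Sum>t | t \<in> mixed_words \<and> b \<in> t. (char_sum t)\<^sup>2) / 16 ^ n = 2"
    "real_of_int (\<Sum>t | t \<in> mixed_words \<and> b \<notin> t. (char_sum t)\<^sup>2) / 16 ^ n = 0"
    unfolding sets sum_mixed_words by simp_all
  note profile = half_fraction_has_profile[OF assms(1) this]
  show ?thesis
    using profile unfolding odd card_odd_word .
qed

end

text \<open>The frequencies sum to \<open>n\<close>. A branching column associated with 0 uses up
  one further entry, and one associated with 2 forces \<open>1 \<le> g\<close>.\<close>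

lemma half_fractions_profile:
  assumes "E \<in> half_fractions n"
  obtains (zero) f g where "has_profile n f g (2 * f + 2) 0 2 E" "f + g + 1 \<le> n"
    | (two) f g where "has_profile n f g (2 * f + 2) 2 0 E" "f + g \<le> n" "1 \<le> g"
    | (odd) f g where "has_profile n f g (2 * f + 1) 1 1 E" "f + g \<le> n"
proof -
  obtain w b where w: "w \<in> carrier_vec n" and hf: "half_fraction (generated_design w) b E"
    using assms by (auto simp: half_fractions_def)
  interpret quaternary_code n w
    by unfold_locales (rule w)
  show ?thesis
    using half_fraction_exhaust[OF hf]
  proof cases
    case 1
    show ?thesis
      by (rule odd[OF has_profile_odd[OF hf 1]]) (use freq_total in linarith)
  next
    case 2
    show ?thesis
      by (rule zero[OF has_profile_0[OF hf 2]]) (use freq_total associated_freq[OF 2] in linarith)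
  next
    case 3
    show ?thesis
      by (rule two[OF has_profile_2[OF hf 3] _ associated_freq[OF 3]]) (use freq_total in linarith)
  qed
qed

section \<open>Reduction of both optimality criteria to numerical comparisons\<close>

lemma resolution_eq:
  assumes "r \<in> {1..card (factors E)}" "0 < max_rho E r"
    and "\<And>j. 1 \<le> j \<Longrightarrow> j < r \<Longrightarrow> max_rho E j \<le> 0"
  shows "resolution E = real r + 1 - max_rho E r"
proof -
  have "(LEAST r. r \<in> {1..card (factors E)} \<and> max_rho E r > 0) = r"
    using assms by (intro Least_equality) (auto simp: not_less[symmetric])
  then show ?thesis
    by (simp add: resolution_def)
qed

text \<open>If the first length with a positive maximum is smaller than \<open>j\<close>, the
  resolution is already below \<open>j\<close>, whereas the bound is at least
  \<open>j\<close>.\<close>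

lemma resolution_le:
  assumes "j \<in> {1..card (factors E)}" "0 < max_rho E j" "max_rho E j \<le> 1"
  shows "resolution E \<le> real j + 1 - max_rho E j"
proof -
  define r where "r = (LEAST r. r \<in> {1..card (factors E)} \<and> max_rho E r > 0)"
  have r: "r \<in> {1..card (factors E)} \<and> max_rho E r > 0" and "r \<le> j"
    unfolding r_def using assms by (auto intro: LeastI2[of _ j] Least_le)
  have res: "resolution E = real r + 1 - max_rho E r"
    by (simp add: resolution_def r_def Let_def)
  show ?thesis
  proof (cases "r = j")
    case True
    then show ?thesis using res by simp
  next
    case False
    then have "real r + 1 \<le> real j" using \<open>r \<le> j\<close> by linarith
    then show ?thesis using res r assms(3) by linarith
  qed
qed

lemma lexordp_eq_map_upt:
  fixes x y :: "nat \<Rightarrow> 'a::linorder"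
  assumes "\<And>j. j < r \<Longrightarrow> m \<le> j \<Longrightarrow> x j \<le> y j" "m \<le> r" "r < N" "x r < y r"
  shows "ord_class.lexordp_eq (map x [m..<N]) (map y [m..<N])"
  using assms(1,2)
proof (induction "r - m" arbitrary: m)
  case 0
  then have "m = r" by simp
  then show ?case
    using assms(3,4) by (simp add: upt_conv_Cons)
next
  case (Suc d)
  then have "x m \<le> y m" "ord_class.lexordp_eq (map x [Suc m..<N]) (map y [Suc m..<N])"
    by (auto intro!: Suc(1))
  moreover have "m < N" using Suc(2) assms(3) by linarith
  ultimately show ?case
    by (auto simp: upt_conv_Cons)
qed

text \<open>A single criterion for both orders, meant for \<open>D\<close> without words shorter
  than \<open>r\<close>: either \<open>E\<close> has a shorter word, or its correlation at
  \<open>r\<close> is at least as large and its pattern is worse at \<open>r\<close> or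
  identical.\<close>

definition dominates :: "nat \<Rightarrow> nat \<Rightarrow> 'r design \<Rightarrow> 'r design \<Rightarrow> bool" where
  "dominates m r D E \<longleftrightarrow>
    (\<exists>j\<in>{1..<r}. 0 < wordlength E j) \<or>
    max_rho D r \<le> max_rho E r \<and>
      (wordlength D r < wordlength E r \<or> (\<forall>j\<in>{1..m}. wordlength E j = wordlength D j))"

lemma optimal_design:
  assumes D: "D \<in> K" "card (factors D) = m" "r \<in> {1..m}"
      "\<And>j. 1 \<le> j \<Longrightarrow> j < r \<Longrightarrow> wordlength D j = 0"
      "\<And>j. 1 \<le> j \<Longrightarrow> j < r \<Longrightarrow> max_rho D j = 0" "0 < max_rho D r" "max_rho D r \<le> 1"
    and card: "\<And>E. E \<in> K \<Longrightarrow> card (factors E) = m"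
    and rho: "\<And>E j. E \<in> K \<Longrightarrow> j \<in> {1..m} \<Longrightarrow> wordlength E j > 0 \<Longrightarrow>
      0 < max_rho E j \<and> max_rho E j \<le> 1"
    and compare: "\<And>E. E \<in> K \<Longrightarrow>
      dominates m r D E"
  shows "maximum_resolution K D \<and> minimum_aberration K D
    \<and> resolution D = real r + 1 - max_rho D r"
proof -
  have nonneg: "0 \<le> wordlength E j" for E :: "'a design" and j
    unfolding wordlength_def by (rule sum_nonneg) simp
  have res: "resolution D = real r + 1 - max_rho D r"
    using D by (intro resolution_eq) auto
  \<comment> \<open>In the second alternative of \<open>dominates\<close> this forces
    \<open>E\<close> to have a word of length \<open>r\<close> as well.\<close>
  have pos: "0 < wordlength D r"
  proof (rule ccontr)
    assume "\<not> ?thesis"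
    then have zero: "wordlength D r = 0"
      using nonneg[of D r] by linarith
    have fin: "finite (factors D)"
      using D(2,3) by (intro card_ge_0_finite) auto
    have fin': "finite (factor_subsets D r)"
      unfolding factor_subsets_def by (rule finite_subset[of _ "Pow (factors D)"]) (use fin in auto)
    then have "\<forall>s\<in>factor_subsets D r. rho D s = 0"
      using zero unfolding wordlength_def by (simp add: sum_nonneg_eq_0_iff)
    moreover have "factor_subsets D r \<noteq> {}"
      unfolding factor_subsets_def using D(2,3) obtain_subset_with_card_n[of r "factors D"] by auto
    ultimately have "rho D ` factor_subsets D r = {0}"
      by auto
    then show False
      using D(6) by (simp add: max_rho_def)
  qed
  have "resolution E \<le> resolution D" if E: "E \<in> K" for E
    using compare[OF E] unfolding dominates_def
  proof
    assume "\<exists>j\<in>{1..<r}. 0 < wordlength E j"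
    then obtain j where j: "1 \<le> j" "j < r" "0 < wordlength E j"
      by auto
    have "0 < max_rho E j \<and> max_rho E j \<le> 1"
      using rho[OF E _ j(3)] j D(3) by auto
    moreover from this have "resolution E \<le> real j + 1 - max_rho E j"
      using j D(3) card[OF E] by (intro resolution_le) auto
    moreover have "real j + 1 \<le> real r"
      using j by linarith
    ultimately show ?thesis
      using res D(7) by linarith
  next
    assume E': "max_rho D r \<le> max_rho E r \<and>
        (wordlength D r < wordlength E r \<or> (\<forall>j\<in>{1..m}. wordlength E j = wordlength D j))"
    then have "0 < wordlength E r"
      using pos D(3) by auto
    then have "max_rho E r \<le> 1"
      using rho[OF E D(3)] by simp
    then have "resolution E \<le> real r + 1 - max_rho E r"
      using E' D(3,6) card[OF E] by (intro resolution_le) auto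
    then show ?thesis
      using res E' by linarith
  qed
  moreover have "ord_class.lexordp_eq (wordlength_pattern D) (wordlength_pattern E)"
    if E: "E \<in> K" for E
  proof -
    consider j where "1 \<le> j" "j \<le> r" "wordlength D j < wordlength E j"
      | "\<forall>j\<in>{1..m}. wordlength E j = wordlength D j"
      using compare[OF E] D(3,4) unfolding dominates_def by force
    then show ?thesis
    proof cases
      case 1
      then show ?thesis
        unfolding wordlength_pattern_def D(2) card[OF E]
        using D(3,4) nonneg by (intro lexordp_eq_map_upt[of j]) auto
    next
      case 2
      then have "wordlength_pattern E = wordlength_pattern D"
        unfolding wordlength_pattern_def D(2) card[OF E] by auto
      then show ?thesis
        by (simp add: lexordp_eq_refl)
    qed
  qed
  ultimately show ?thesis
    using D(1) res by (auto simp: maximum_resolution_def minimum_aberration_def)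
qed

text \<open>The numerical assumptions say that no part of the profile of \<open>D\<close> with
  nonzero weight lies below \<open>r\<close> and that \<open>r\<close> is attained. What is left is
  a comparison with each of the three families.\<close>

lemma profile_optimal:
  assumes D: "D \<in> half_fractions n" "has_profile n f g w p q D"
      "r \<in> {1..2 * n + 1}" "0 \<le> p" "0 \<le> q" "r \<le> w"
      "p = 0 \<or> r \<le> f + 2 * g" "r \<le> f + 2 * g + 1" "0 < wordlength D r"
    and zero: "\<And>f' g' (E :: z4 vec design). has_profile n f' g' (2 * f' + 2) 0 2 E \<Longrightarrow> f' + g' + 1 \<le> n \<Longrightarrow>
      dominates (2 * n + 1) r D E"
    and two: "\<And>f' g' (E :: z4 vec design). has_profile n f' g' (2 * f' + 2) 2 0 E \<Longrightarrow> f' + g' \<le> n \<Longrightarrow> 1 \<le> g' \<Longrightarrow>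
      dominates (2 * n + 1) r D E"
    and odd: "\<And>f' g' (E :: z4 vec design). has_profile n f' g' (2 * f' + 1) 1 1 E \<Longrightarrow> f' + g' \<le> n \<Longrightarrow>
      dominates (2 * n + 1) r D E"
  shows "maximum_resolution (half_fractions n) D \<and> minimum_aberration (half_fractions n) D
    \<and> resolution D = real r + 1 - max_rho D r"
proof (rule optimal_design)
  have rho: "0 < max_rho E j \<and> max_rho E j \<le> 1"
    if "has_profile n f' g' w' p' q' E" "j \<in> {1..2 * n + 1}" "0 < wordlength E j"
    for f' g' w' j :: nat and p' q' :: real and E :: "z4 vec design"
    using has_profileD(3)[OF that(1,2)] that(3) by (auto simp: divide_le_eq_1)
  show "D \<in> half_fractions n" "card (factors D) = 2 * n + 1" "r \<in> {1..2 * n + 1}"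
    using D has_profileD(1) by blast+
  show "0 < max_rho D r" "max_rho D r \<le> 1"
    using rho[OF D(2,3,9)] by auto
  fix j assume j: "1 \<le> j" "j < r"
  then have "wordlength D j = 0"
    using has_profileD(2)[OF D(2), of j] D(3,6,7,8) by auto
  moreover from this have "max_rho D j = 0"
    using has_profileD(3)[OF D(2), of j] D(3,6) j by auto
  ultimately show "wordlength D j = 0" "max_rho D j = 0" .
next
  fix E assume E: "E \<in> half_fractions n"
  then show "card (factors E) = 2 * n + 1"
    by (cases rule: half_fractions_profile) (auto dest: has_profileD(1))
  show "dominates (2 * n + 1) r D E"
    using E
  proof (cases rule: half_fractions_profile)
    case (zero f' g')
    then show ?thesis by (rule assms(10))
  next
    case (two f' g')
    then show ?thesis by (rule assms(11))
  next
    case (odd f' g')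
    then show ?thesis by (rule assms(12))
  qed
next
  fix E j assume "E \<in> half_fractions n" and j: "j \<in> {1..2 * n + 1}" "0 < wordlength E j"
  then obtain f' g' w' p' q' where "has_profile n f' g' w' p' q' E"
    by (metis half_fractions_profile)
  then show "0 < max_rho E j \<and> max_rho E j \<le> 1"
    using has_profileD(3)[OF _ j(1)] j(2) by (fastforce simp: divide_le_eq_1)
qed

text \<open>Any nonempty word shorter than \<open>r\<close> decides the comparison. The bound on
  \<open>r\<close> keeps its length in the range covered by a profile.\<close>

lemma dominates_if_short_word:
  assumes "has_profile n f g w p q E" "0 \<le> p" "0 \<le> q" "r \<le> 2 * n + 2"
    and "1 \<le> w \<and> w < r \<or> 0 < p \<and> 1 \<le> f + 2 * g \<and> f + 2 * g < r \<or> 0 < q \<and> f + 2 * g + 1 < r"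
  shows "dominates m r D E"
proof -
  have pos: "0 < wordlength E j"
    if "j \<in> {1..<r}" "j = w \<or> 0 < p \<and> j = f + 2 * g \<or> 0 < q \<and> j = f + 2 * g + 1" for j
    using has_profileD(2)[OF assms(1), of j] that assms(2-4) by (auto simp: add_pos_nonneg)
  show ?thesis
    using assms(5) pos[of w] pos[of "f + 2 * g"] pos[of "f + 2 * g + 1"]
    unfolding dominates_def by force
qed

section \<open>Optimality in the three residue classes of \<open>n\<close>\<close>

theorem theorem8:
  fixes n k b :: nat and v :: "z4 vec" and D D' :: "z4 vec design"
  assumes "n \<ge> 1" and "k \<ge> 1"
    and "v \<in> carrier_vec n"
    and "D = generated_design v"
    and "half_fraction D b D'"
  shows
    "(n = 3 * k - 1 \<and> freq v 1 + freq v 3 = 2 * k - 1 \<and> freq v 2 = k \<and> associated v b 2 \<longrightarrow>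
        maximum_resolution (half_fractions n) D' \<and>
        minimum_aberration (half_fractions n) D' \<and>
        resolution D' = 4 * real k - 1 / 2 ^ (k - 1) \<and>
        (\<forall>j\<in>{1..2 * n + 1}. wordlength D' j =
          (if j = 4 * k - 1 then 2 else if j = 4 * k then 1 else 0))) \<and>
     (n = 3 * k \<and> freq v 1 + freq v 3 = 2 * k \<and> freq v 2 = k \<and> associated v b 1 \<longrightarrow>
        maximum_resolution (half_fractions n) D' \<and>
        minimum_aberration (half_fractions n) D' \<and>
        resolution D' = 4 * real k + 1 - 1 / 2 ^ k \<and>
        (\<forall>j\<in>{1..2 * n + 1}. wordlength D' j =
          (if j = 4 * k then 1 else if j = 4 * k + 1 then 2 else 0))) \<and>
     (n = 3 * k + 1 \<and> freq v 1 + freq v 3 = 2 * k \<and> freq v 2 = k + 1 \<and> associated v b 2 \<longrightarrow>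
        maximum_resolution (half_fractions n) D' \<and>
        minimum_aberration (half_fractions n) D' \<and>
        resolution D' = 4 * real k + 2 \<and>
        (\<forall>j\<in>{1..2 * n + 1}. wordlength D' j = (if j = 4 * k + 2 then 3 else 0)))"
proof -
  interpret quaternary_code n v
    by unfold_locales (rule assms(3))
  have hf: "half_fraction (generated_design v) b D'"
    using assms(4,5) by simp
  then have mem: "D' \<in> half_fractions n"
    using assms(3) by (auto simp: half_fractions_def)
  let ?f = "freq v 1 + freq v 3" and ?g = "freq v 2"
  have a: "maximum_resolution (half_fractions n) D' \<and> minimum_aberration (half_fractions n) D' \<and>
      resolution D' = 4 * real k - 1 / 2 ^ (k - 1) \<and>
      (\<forall>j\<in>{1..2 * n + 1}. wordlength D' j =
        (if j = 4 * k - 1 then 2 else if j = 4 * k then 1 else 0))"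
    if n: "n = 3 * k - 1" and f: "?f = 2 * k - 1" and g: "?g = k" and b: "associated v b 2"
  proof -
    have w: "2 * (2 * k - 1) + 2 = 4 * k"
      using assms(2) by linarith
    \<comment> \<open>All mixed words contain \<open>b\<close> and drop to length
      \<open>4 * k - 1\<close>, while \<open>odd_word\<close> keeps its length
      \<open>4 * k\<close>.\<close>
    have profile: "has_profile n (2 * k - 1) k (4 * k) 2 0 D'"
      using has_profile_2[OF hf b] unfolding f g w .
    have A: "wordlength D' j = (if j = 4 * k - 1 then 2 else if j = 4 * k then 1 else 0)"
      if "j \<in> {1..2 * n + 1}" for j
      using has_profileD(2)[OF profile that] assms(2) by auto
    have r: "4 * k - 1 \<in> {1..2 * n + 1}"
      using assms(2) n by auto
    have "(2 * k - 1) div 2 = k - 1"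
      using assms(2) by presburger
    then have rho: "max_rho D' (4 * k - 1) = 1 / 2 ^ (k - 1)"
      using has_profileD(3)[OF profile r] A[OF r] assms(2) by auto
    have "maximum_resolution (half_fractions n) D' \<and> minimum_aberration (half_fractions n) D' \<and>
        resolution D' = real (4 * k - 1) + 1 - max_rho D' (4 * k - 1)"
    proof (rule profile_optimal[OF mem profile r])
      fix f' g' and E :: "z4 vec design"
      assume E: "has_profile n f' g' (2 * f' + 2) 0 2 E" "f' + g' + 1 \<le> n"
      have "2 * f' + 2 < 4 * k - 1 \<or> f' + 2 * g' + 1 < 4 * k - 1"
        using E(2) n assms(2) by linarith
      then show "dominates (2 * n + 1) (4 * k - 1) D' E"
        by (intro dominates_if_short_word[OF E(1)]) (use n assms(2) in auto)
    next
      fix f' g' and E :: "z4 vec design"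
      assume E: "has_profile n f' g' (2 * f' + 2) 2 0 E" "f' + g' \<le> n" "1 \<le> g'"
      \<comment> \<open>If \<open>2 * f' + 2\<close> reaches \<open>4 * k - 1\<close>, then
        \<open>f'\<close> is at least \<open>2 * k - 1\<close> and \<open>g'\<close> at most
        \<open>k\<close>, so \<open>f' + 2 * g' \<le> n + g'\<close> reaches
        \<open>4 * k - 1\<close> only with equality throughout.\<close>
      consider "2 * f' + 2 < 4 * k - 1 \<or> f' + 2 * g' < 4 * k - 1" | "f' = 2 * k - 1" "g' = k"
        using E(2) n assms(2) by linarith
      then show "dominates (2 * n + 1) (4 * k - 1) D' E"
      proof cases
        case 1
        show ?thesis
          by (rule dominates_if_short_word[OF E(1)]) (use 1 n E(3) in auto)
      next
        case 2
        then have "2 * f' + 2 = 4 * k"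
          using assms(2) by linarith
        then have same: "wordlength E j = wordlength D' j" "max_rho E j = max_rho D' j"
          if "j \<in> {1..2 * n + 1}" for j
          using has_profileD(2,3)[OF profile that] has_profileD(2,3)[OF E(1) that] 2 by simp_all
        then show ?thesis using same(2)[OF r] by (simp add: dominates_def)
      qed
    next
      fix f' g' and E :: "z4 vec design"
      assume E: "has_profile n f' g' (2 * f' + 1) 1 1 E" "f' + g' \<le> n"
      consider "2 * f' + 1 < 4 * k - 1" | "2 * f' + 1 \<ge> 4 * k - 1" "f' + 2 * g' < 4 * k - 1"
        | "f' = 2 * k - 1" "g' = k"
        using E(2) n assms(2) by linarith
      then show "dominates (2 * n + 1) (4 * k - 1) D' E"
      proof cases
        case 1
        show ?thesis
          by (rule dominates_if_short_word[OF E(1)]) (use 1 n in auto)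
      next
        case 2
        show ?thesis
          by (rule dominates_if_short_word[OF E(1)]) (use 2 n assms(2) in auto)
      next
        case 3
        \<comment> \<open>A tie in aberration: the shortened \<open>odd_word\<close> and half of the
          mixed weight have length \<open>4 * k - 1\<close>, the other half \<open>4 * k\<close>.
          The resolution is no larger, since \<open>odd_word\<close> has correlation 1.\<close>
        then have w: "2 * f' + 1 = 4 * k - 1" "f' + 2 * g' = 4 * k - 1"
          using assms(2) by auto
        have "wordlength E j = wordlength D' j" if "j \<in> {1..2 * n + 1}" for j
          using has_profileD(2)[OF E(1) that] A[OF that] assms(2) unfolding w by auto
        moreover have "max_rho E (4 * k - 1) = 1"
          using has_profileD(3)[OF E(1) r] w by simp
        ultimately show ?thesis using rho by (simp add: dominates_def)
      qed
    qed (use A[OF r] assms(2) in auto)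
    then show ?thesis
      using A rho assms(2) by (simp add: of_nat_diff)
  qed
  have b: "maximum_resolution (half_fractions n) D' \<and> minimum_aberration (half_fractions n) D' \<and>
      resolution D' = 4 * real k + 1 - 1 / 2 ^ k \<and>
      (\<forall>j\<in>{1..2 * n + 1}. wordlength D' j =
        (if j = 4 * k then 1 else if j = 4 * k + 1 then 2 else 0))"
    if n: "n = 3 * k" and f: "?f = 2 * k" and g: "?g = k" and b: "associated v b 1"
  proof -
    \<comment> \<open>The shortened \<open>odd_word\<close> has the same length
      \<open>4 * k + 1\<close> as the mixed words without \<open>b\<close>, which gives the entry 2
      there.\<close>
    have profile: "has_profile n (2 * k) k (4 * k + 1) 1 1 D'"
      using has_profile_odd[OF hf associated_1_odd_word[OF b]] unfolding f g by simp
    have A: "wordlength D' j = (if j = 4 * k then 1 else if j = 4 * k + 1 then 2 else 0)"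
      if "j \<in> {1..2 * n + 1}" for j
      using has_profileD(2)[OF profile that] by auto
    have r: "4 * k \<in> {1..2 * n + 1}"
      using assms(2) n by auto
    have rho: "max_rho D' (4 * k) = 1 / 2 ^ k"
      using has_profileD(3)[OF profile r] A[OF r] by auto
    have "maximum_resolution (half_fractions n) D' \<and> minimum_aberration (half_fractions n) D' \<and>
        resolution D' = real (4 * k) + 1 - max_rho D' (4 * k)"
    proof (rule profile_optimal[OF mem profile r])
      fix f' g' and E :: "z4 vec design"
      assume E: "has_profile n f' g' (2 * f' + 2) 0 2 E" "f' + g' + 1 \<le> n"
      consider "2 * f' + 2 < 4 * k \<or> f' + 2 * g' + 1 < 4 * k" | "f' = 2 * k - 1" "g' = k"
        using E(2) n assms(2) by linarith
      then show "dominates (2 * n + 1) (4 * k) D' E"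
      proof cases
        case 1
        show ?thesis
          by (rule dominates_if_short_word[OF E(1)]) (use 1 n in auto)
      next
        case 2
        then have w: "2 * f' + 2 = 4 * k" "f' + 2 * g' + 1 = 4 * k"
          using assms(2) by auto
        then have "wordlength E (4 * k) = 3" "max_rho E (4 * k) = 1"
          using has_profileD(2,3)[OF E(1) r] by simp_all
        then show ?thesis
          using A[OF r] rho by (simp add: dominates_def)
      qed
    next
      fix f' g' and E :: "z4 vec design"
      assume E: "has_profile n f' g' (2 * f' + 2) 2 0 E" "f' + g' \<le> n" "1 \<le> g'"
      consider "2 * f' + 2 < 4 * k \<or> f' + 2 * g' < 4 * k" | "f' = 2 * k" "g' = k"
        | "f' = 2 * k - 1" "g' = k + 1"
        using E(2) n assms(2) by linarith
      then show "dominates (2 * n + 1) (4 * k) D' E"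
      proof cases
        case 1
        show ?thesis
          by (rule dominates_if_short_word[OF E(1)]) (use 1 n E(3) in auto)
      next
        case 2
        then have "wordlength E (4 * k) = 2" "max_rho E (4 * k) = 1 / 2 ^ k"
          using has_profileD(2,3)[OF E(1) r] by simp_all
        then show ?thesis
          using A[OF r] rho by (simp add: dominates_def)
      next
        case 3
        \<comment> \<open>Another tie in aberration, with the roles exchanged:
          \<open>odd_word\<close> has the shorter length \<open>4 * k\<close> and correlation 1, and
          the mixed words give 2 at \<open>4 * k + 1\<close>.\<close>
        then have w: "2 * f' + 2 = 4 * k" "f' + 2 * g' = 4 * k + 1"
          using assms(2) by auto
        have "wordlength E j = wordlength D' j" if "j \<in> {1..2 * n + 1}" for j
          using has_profileD(2)[OF E(1) that] A[OF that] unfolding w by auto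
        moreover have "max_rho E (4 * k) = 1"
          using has_profileD(3)[OF E(1) r] w by simp
        ultimately show ?thesis using rho by (simp add: dominates_def)
      qed
    next
      fix f' g' and E :: "z4 vec design"
      assume E: "has_profile n f' g' (2 * f' + 1) 1 1 E" "f' + g' \<le> n"
      consider "2 * f' + 1 < 4 * k" | "2 * f' + 1 \<ge> 4 * k" "f' + 2 * g' < 4 * k"
        | "f' = 2 * k" "g' = k"
        using E(2) n assms(2) by linarith
      then show "dominates (2 * n + 1) (4 * k) D' E"
      proof cases
        case 1
        show ?thesis
          by (rule dominates_if_short_word[OF E(1)]) (use 1 n in auto)
      next
        case 2
        \<comment> \<open>Makes the length \<open>f' + 2 * g'\<close> positive, so that it belongs
          to a nonempty word.\<close>
        then have "1 \<le> f'"
          using assms(2) by linarith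
        show ?thesis
          by (rule dominates_if_short_word[OF E(1)]) (use 2 n \<open>1 \<le> f'\<close> in auto)
      next
        case 3
        have same: "wordlength E j = wordlength D' j" "max_rho E j = max_rho D' j"
          if "j \<in> {1..2 * n + 1}" for j
          using has_profileD(2,3)[OF profile that] has_profileD(2,3)[OF E(1) that] 3 by simp_all
        then show ?thesis using same(2)[OF r] by (simp add: dominates_def)
      qed
    qed (use A[OF r] in auto)
    then show ?thesis
      using A rho by simp
  qed
  have c: "maximum_resolution (half_fractions n) D' \<and> minimum_aberration (half_fractions n) D' \<and>
      resolution D' = 4 * real k + 2 \<and>
      (\<forall>j\<in>{1..2 * n + 1}. wordlength D' j = (if j = 4 * k + 2 then 3 else 0))"
    if n: "n = 3 * k + 1" and f: "?f = 2 * k" and g: "?g = k + 1" and b: "associated v b 2"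
  proof -
    \<comment> \<open>\<open>odd_word\<close> and the shortened mixed words all have length
      \<open>4 * k + 2\<close>, whence the single entry \<open>1 + 2\<close>.\<close>
    have profile: "has_profile n (2 * k) (k + 1) (4 * k + 2) 2 0 D'"
      using has_profile_2[OF hf b] unfolding f g by simp
    have A: "wordlength D' j = (if j = 4 * k + 2 then 3 else 0)"
      if "j \<in> {1..2 * n + 1}" for j
      using has_profileD(2)[OF profile that] by auto
    have r: "4 * k + 2 \<in> {1..2 * n + 1}"
      using assms(2) n by auto
    have rho: "max_rho D' (4 * k + 2) = 1"
      using has_profileD(3)[OF profile r] by simp
    have "maximum_resolution (half_fractions n) D' \<and> minimum_aberration (half_fractions n) D' \<and>
        resolution D' = real (4 * k + 2) + 1 - max_rho D' (4 * k + 2)"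
    proof (rule profile_optimal[OF mem profile r])
      fix f' g' and E :: "z4 vec design"
      assume E: "has_profile n f' g' (2 * f' + 2) 0 2 E" "f' + g' + 1 \<le> n"
      have "2 * f' + 2 < 4 * k + 2 \<or> f' + 2 * g' + 1 < 4 * k + 2"
        using E(2) n by linarith
      then show "dominates (2 * n + 1) (4 * k + 2) D' E"
        by (intro dominates_if_short_word[OF E(1)]) (use n in auto)
    next
      fix f' g' and E :: "z4 vec design"
      assume E: "has_profile n f' g' (2 * f' + 2) 2 0 E" "f' + g' \<le> n" "1 \<le> g'"
      consider "2 * f' + 2 < 4 * k + 2 \<or> f' + 2 * g' < 4 * k + 2" | "f' = 2 * k" "g' = k + 1"
        using E(2) n by linarith
      then show "dominates (2 * n + 1) (4 * k + 2) D' E"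
      proof cases
        case 1
        show ?thesis
          by (rule dominates_if_short_word[OF E(1)]) (use 1 n E(3) in auto)
      next
        case 2
        have same: "wordlength E j = wordlength D' j" "max_rho E j = max_rho D' j"
          if "j \<in> {1..2 * n + 1}" for j
          using has_profileD(2,3)[OF profile that] has_profileD(2,3)[OF E(1) that] 2 by simp_all
        then show ?thesis using same(2)[OF r] by (simp add: dominates_def)
      qed
    next
      fix f' g' and E :: "z4 vec design"
      assume E: "has_profile n f' g' (2 * f' + 1) 1 1 E" "f' + g' \<le> n"
      \<comment> \<open>By parity, \<open>2 * f' + 1 \<ge> 4 * k + 2\<close> forces
        \<open>f' \<ge> 2 * k + 1\<close>, hence \<open>g' \<le> k\<close> and
        \<open>f' + 2 * g' \<le> 4 * k + 1\<close>.\<close>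
      have "2 * f' + 1 < 4 * k + 2 \<or> 1 \<le> f' + 2 * g' \<and> f' + 2 * g' < 4 * k + 2"
        using E(2) n by linarith
      then show "dominates (2 * n + 1) (4 * k + 2) D' E"
        by (intro dominates_if_short_word[OF E(1)]) (use n in auto)
    qed (use A[OF r] in auto)
    then show ?thesis
      using A rho by simp
  qed
  show ?thesis
    using a b c by blast
qed

end
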